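(* Let $p,q\ge1$ and let $Q\in\mathcal{Q}^1_{p,q}$ (the case $m=1$), with parameters $r_1',r_1'',r_2',r_2''$ and $s_1',s_1'',s_2',s_2''$ as defined in the context. Then $$p=(r_1'+r_1'')+2(r_2'+r_2''),\qquad q=(s_1'+s_1'')+2(s_2'+s_2'').$$
   Context: **Colored quivers.** Let $m\ge 1$ (here $m=1$). An $m$-colored quiver $Q$ is a finite quiver with vertex set $Q_0$ in which every arrow carries a color in $\{0,1,\dots,m\}$; $q_{ij}^{(c)}$ is the number of arrows $i\to j$ of color $c$. All $m$-colored quivers are assumed to have no loops ($q_{ii}^{(c)}=0$), to be monochromatic (if $q_{ij}^{(c)}\ne 0$ then $q_{ij}^{(c')}=0$ for all $c'\neq c$) and skew-symmetric ($q_{ij}^{(c)}=q_{ji}^{(m-c)}$). So arrows come in opposite pairs of colors $c$ and $m-c$; the underlying graph is obtained by replacing each such pair by one edge. Two vertices are neighbors if there are arrows between them. $Q$ is simple if $\sum_c q_{ij}^{(c)}\le 1$ for all $i\ne j$. $\overline{ij}$ denotes the color of the arrow(s) $i\to j$. A cycle $(x_1x_2\cdots x_k)$ consists of arrows $x_1\to x_2\to\cdots\to x_k\to x_1$ with distinct $x_i$, and $\overline{(x_1\cdots x_k)}$ is the sum of their colors. $Q[I]$ is the induced subquiver on $I\subseteq Q_0$. A hole is a set of at least four vertices inducing a subquiver whose underlying graph is a cycle. A clique is a set of pairwise neighboring vertices (identified with the induced subquiver). A triangle is a 3-element clique; a triangle $(xyz)$ is $m$-admissible if $\overline{xy}+\overline{yz}+\overline{zx}\in\{m-1,2m+1\}$.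 **The class $\mathcal{Q}^m_n$**: connected simple $m$-colored quivers with $n$ vertices and no holes such that (i) for every vertex $v$ with $z\ge1$ neighbors there are cliques $\mathcal C$ and $\mathcal B$, of sizes $r,k\le m+2$, with $\mathcal C\cap\mathcal B=\{v\}$, $r+k=z+2$ (so the neighbors of $v$ are exactly the vertices of $(\mathcal C\cup\mathcal B)\setminus\{v\}$), and no arrows between $\mathcal C\setminus\{v\}$ and $\mathcal B\setminus\{v\}$; (ii) every triangle is $m$-admissible. **The class $\mathcal{Q}^m_{p,q}$.** A cycle $(a_1\cdots a_l)$ is $(l,h)$-central if $h$ is an integer with $0<h<l$ and $\overline{(a_1\cdots a_l)}=h\cdot m$. $\mathcal{Q}^m_{p,q}$ is the class of connected $m$-colored quivers $Q$ with $p+q$ vertices such that: (a) There is a unique set of vertices $\{a_1,\dots,a_l\}$, $l\ge2$ (the central vertices), such that $Q[a_1,\dots,a_l]$ is a cycle $\Delta=\Delta_l^m=(a_1\cdots a_l)$ (the central cycle) that is $(l,h)$-central for some $h$; for $l=2$ this means that $a_1,a_2$ are joined by two parallel pairs of opposite arrows (then $h=1$). (b) If $l=2$, then $q_{a_1a_2}^{(c)}=q_{a_2a_1}^{(m-c)}=2$ for some $c$, and for every other pair of distinct vertices there is at most one arrow from the first to the second. If $l\ge3$, $Q$ is simple. (c) If $l\le 3$, $Q$ has no holes; if $l\ge4$, the only hole of $Q$ is $\{a_1,\dots,a_l\}$. (d) For every vertex $v$ with $z\ge1$ neighbors there are cliques $\mathcal C,\mathcal B$ of sizes $r,k$ with $1\le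 r,k\le m+2$ and $v\in\mathcal C\cap\mathcal B$, whose union is $v$ together with all its neighbors. If $l\geq 3$ or $v$ is not central, then $\mathcal C\cap\mathcal B=\{v\}$, $z=r+k-2$, and there are no arrows between $u\in\mathcal C\setminus\{v\}$ and $w\in\mathcal B\setminus\{v\}$, except when $l=3$ and $\{u,v,w\}=\{a_1,a_2,a_3\}$. If $l=2$ and $v\in\{a_1,a_2\}$, then $\mathcal C\cap\mathcal B=\{a_1,a_2\}$, $z=r+k-3$, and there are no arrows between $\mathcal C\setminus\{a_1,a_2\}$ and $\mathcal B\setminus\{a_1,a_2\}$. (e) For each arrow $\alpha_i:a_i\to a_{i+1}$ of $\Delta$ (indices mod $l$) there is a unique maximal clique $D_i\supseteq\{a_i,a_{i+1}\}$ (other than $\{a_1,a_2,a_3\}$ if $l=3$), and it has size at most $m+2$; for $l=2$, $D_1,D_2$ are the two cliques in (d) at the central vertices, each regarded as containing one of the two parallel pairs of arrows, $D_1$ corresponding to $\alpha_1:a_1\to a_2$ and $D_2$ to $\alpha_2:a_2\to a_1$. $D_i$ is called a boundary subquiver (it may be just $\{a_i,a_{i+1}\}$). (f) Every triangle is $m$-admissible, except $\Delta_3^m$ if $l=3$. (g) The vertices in $D_i\setminus\{a_i,a_{i+1}\}$ are called peripheral; $W$ is the set of all peripheral vertices. Each $w\in W$ lies in $D_i$ for a unique $i$; put $T_w=(a_i\,a_{i+1}\,w)$. Let $W_p=\{w\in W:\overline{T_w}=m-1\}$ and $W_q=\{w\in W:\overline{T_w}=2m+1\}$. Removing from $Q$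 all arrows of all $D_i$ and all central vertices leaves a disjoint union $\bigsqcup_{w\in W}Q_w$ of connected quivers with $w\in Q_w$ and $Q_w\in\mathcal{Q}^m_{n_w}$, where $n_w=|(Q_w)_0|$. With $x_p=\sum_{w\in W_p}n_w$ and $x_q=\sum_{w\in W_q}n_w$, one has $p=l-h+x_p$ and $q=h+x_q$, for a suitable choice of the direction of $\Delta$ (reversing it replaces $h$ by $l-h$ and interchanges $W_p$ and $W_q$). **Parameters ($m=1$).** Fix the direction $(a_1a_2\cdots a_l)$ of the central cycle for which (g) holds and call it counterclockwise; the opposite direction is clockwise. Each edge of $Q$ carries exactly one arrow of color $0$; below, arrows are arrows of color $0$, one for each edge, and an oriented 3-cycle is a 3-cycle all of whose arrows have color $0$. The central arrows are the color-$0$ arrows on the $l$ edges of the central cycle: the edge of $\alpha_i:a_i\to a_{i+1}$ carries a counterclockwise central arrow if $\overline{\alpha_i}=0$ and a clockwise one if $\overline{\alpha_i}=1$. For $l=2$, the two parallel edges are treated separately, the $i$-th one being the edge belonging to $D_i$ and counted only in 3-cycles inside $D_i$ (and for $l=2$ the edge of $\alpha_1$ is directed $a_1\to a_2$ and that of $\alpha_2$ is directed $a_2\to a_1$ in the counterclockwise direction). - $r_1'$ is the number of counterclockwise oriented central arrows of color $0$ that do not belong to any oriented 3-cycle. - $r_2'$ is the number of oriented 3-cycles $\alpha\beta\gamma$ in which $\alpha$ is a counterclockwise oriented central arrow of color $0$. - For $w\in W_p$, $r_{1,w}''$ is the number of arrows in $Q_w$ not belonging to any oriented 3-cycle and $r_{2,w}''$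 is the number of oriented 3-cycles in $Q_w$; $r_1''=\sum_{w\in W_p}r_{1,w}''$ and $r_2''=\sum_{w\in W_p}r_{2,w}''$. - $s_1',s_2',s_1'',s_2''$ are defined in the same way, replacing counterclockwise by clockwise and $W_p$ by $W_q$. *)

theory Defs
  imports Main
begin

text \<open>A quiver is given by its vertex set and the numbers \<open>arr Q i j c\<close> of arrows
  \<open>i \<rightarrow> j\<close> of color \<open>c\<close>.\<close>

record 'a cquiver =
  verts :: "'a set"
  arr :: "'a \<Rightarrow> 'a \<Rightarrow> nat \<Rightarrow> nat"

definition colored_quiver :: "nat \<Rightarrow> 'a cquiver \<Rightarrow> bool" where
  "colored_quiver m Q \<longleftrightarrow>
     1 \<le> m \<and> finite (verts Q) \<and>
     (\<forall>i j c. arr Q i j c \<noteq> 0 \<longrightarrow> i \<in> verts Q \<and> j \<in> verts Q \<and> c \<le> m) \<and>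
     (\<forall>i c. arr Q i i c = 0) \<and>
     (\<forall>i j c c'. arr Q i j c \<noteq> 0 \<and> c' \<noteq> c \<longrightarrow> arr Q i j c' = 0) \<and>
     (\<forall>i j c. c \<le> m \<longrightarrow> arr Q i j c = arr Q j i (m - c))"

definition neighbors :: "'a cquiver \<Rightarrow> 'a \<Rightarrow> 'a \<Rightarrow> bool" where
  "neighbors Q x y \<longleftrightarrow> (\<exists>c. arr Q x y c \<noteq> 0)"

definition nbrs :: "'a cquiver \<Rightarrow> 'a \<Rightarrow> 'a set" where
  "nbrs Q v = {u. neighbors Q v u}"

text \<open>The number of arrows \<open>x \<rightarrow> y\<close> of any color; as arrows come in opposite pairs, this is
  the number of edges between \<open>x\<close> and \<open>y\<close> in the underlying (multi)graph.\<close>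

definition mult :: "nat \<Rightarrow> 'a cquiver \<Rightarrow> 'a \<Rightarrow> 'a \<Rightarrow> nat" where
  "mult m Q x y = (\<Sum>c\<le>m. arr Q x y c)"

definition simple_quiver :: "nat \<Rightarrow> 'a cquiver \<Rightarrow> bool" where
  "simple_quiver m Q \<longleftrightarrow> (\<forall>x y. x \<noteq> y \<longrightarrow> mult m Q x y \<le> 1)"

definition induced :: "'a cquiver \<Rightarrow> 'a set \<Rightarrow> 'a cquiver" where
  "induced Q I = \<lparr>verts = verts Q \<inter> I,
                  arr = (\<lambda>x y c. if x \<in> I \<and> y \<in> I then arr Q x y c else 0)\<rparr>"

definition adj :: "'a cquiver \<Rightarrow> ('a \<times> 'a) set" where
  "adj Q = {(x, y). neighbors Q x y}"

definition connected_quiver :: "'a cquiver \<Rightarrow> bool" where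
  "connected_quiver Q \<longleftrightarrow>
     verts Q \<noteq> {} \<and> (\<forall>x\<in>verts Q. \<forall>y\<in>verts Q. (x, y) \<in> (adj Q)\<^sup>*)"

text \<open>The color of the arrows \<open>x \<rightarrow> y\<close>: well defined between neighbors, since quivers are
  monochromatic, and unspecified otherwise.\<close>

definition col :: "'a cquiver \<Rightarrow> 'a \<Rightarrow> 'a \<Rightarrow> nat" where
  "col Q x y = (THE c. arr Q x y c \<noteq> 0)"

definition nxt :: "'a list \<Rightarrow> nat \<Rightarrow> 'a" where
  "nxt xs i = xs ! (Suc i mod length xs)"

definition cycle_color :: "'a cquiver \<Rightarrow> 'a list \<Rightarrow> nat" where
  "cycle_color Q xs = (\<Sum>i<length xs. col Q (xs ! i) (nxt xs i))"

text \<open>The subquiver induced on \<open>set xs\<close> has as underlying graph exactly the cycle visiting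
  \<open>xs\<close> in this order. For length two the right-hand side below is \<open>2\<close> for the two distinct
  vertices, that is, the cycle consists of two parallel edges.\<close>

definition induced_cycle :: "nat \<Rightarrow> 'a cquiver \<Rightarrow> 'a list \<Rightarrow> bool" where
  "induced_cycle m Q xs \<longleftrightarrow>
     2 \<le> length xs \<and> distinct xs \<and> set xs \<subseteq> verts Q \<and>
     (\<forall>i<length xs. \<forall>j<length xs.
        mult m Q (xs ! i) (xs ! j) =
          (if j = Suc i mod length xs then 1 else 0) +
          (if i = Suc j mod length xs then 1 else 0))"

definition hole :: "nat \<Rightarrow> 'a cquiver \<Rightarrow> 'a set \<Rightarrow> bool" where
  "hole m Q S \<longleftrightarrow> 4 \<le> card S \<and> (\<exists>xs. set xs = S \<and> induced_cycle m Q xs)"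

definition clique :: "'a cquiver \<Rightarrow> 'a set \<Rightarrow> bool" where
  "clique Q C \<longleftrightarrow> C \<subseteq> verts Q \<and> (\<forall>x\<in>C. \<forall>y\<in>C. x \<noteq> y \<longrightarrow> neighbors Q x y)"

definition triangle :: "'a cquiver \<Rightarrow> 'a \<Rightarrow> 'a \<Rightarrow> 'a \<Rightarrow> bool" where
  "triangle Q x y z \<longleftrightarrow> distinct [x, y, z] \<and> clique Q {x, y, z}"

definition admissible :: "nat \<Rightarrow> 'a cquiver \<Rightarrow> 'a \<Rightarrow> 'a \<Rightarrow> 'a \<Rightarrow> bool" where
  "admissible m Q x y z \<longleftrightarrow> cycle_color Q [x, y, z] \<in> {m - 1, 2 * m + 1}"

text \<open>The closed neighborhood of \<open>v\<close> is the union of two cliques of size at most \<open>m + 2\<close>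
  meeting exactly in \<open>S\<close>. With \<open>r\<close>, \<open>k\<close> the sizes and \<open>z\<close> the number of neighbors, the last
  equation is \<open>z = r + k - 2\<close> for \<open>S = {v}\<close>, and \<open>z = r + k - 3\<close> if \<open>S\<close> has two elements.\<close>

definition clique_pair :: "nat \<Rightarrow> 'a cquiver \<Rightarrow> 'a \<Rightarrow> 'a set \<Rightarrow> 'a set \<Rightarrow> 'a set \<Rightarrow> bool" where
  "clique_pair m Q v S C B \<longleftrightarrow>
     v \<in> S \<and> clique Q C \<and> clique Q B \<and>
     card C \<in> {1..m + 2} \<and> card B \<in> {1..m + 2} \<and>
     C \<inter> B = S \<and> C \<union> B = insert v (nbrs Q v) \<and>
     card C + card B = card (nbrs Q v) + 1 + card S"

subsection \<open>The class \<open>\<Q>\<^sup>m\<^sub>n\<close>\<close>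

definition Qn :: "nat \<Rightarrow> nat \<Rightarrow> 'a cquiver set" where
  "Qn m n = {Q.
     colored_quiver m Q \<and> connected_quiver Q \<and> simple_quiver m Q \<and>
     card (verts Q) = n \<and> (\<nexists>S. hole m Q S) \<and>
     (\<forall>v\<in>verts Q. nbrs Q v \<noteq> {} \<longrightarrow>
        (\<exists>C B. clique_pair m Q v {v} C B \<and>
               (\<forall>u\<in>C - {v}. \<forall>w\<in>B - {v}. \<not> neighbors Q u w))) \<and>
     (\<forall>x y z. triangle Q x y z \<longrightarrow> admissible m Q x y z)}"

subsection \<open>The class \<open>\<Q>\<^sup>m\<^sub>p\<^sub>,\<^sub>q\<close>\<close>

text \<open>In the sequel \<open>a = [a ! 0, \<dots>, a ! (l - 1)]\<close> is the central cycle in a chosen direction,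
  and \<open>D i\<close> is the boundary subquiver belonging to the arrow \<open>a ! i \<rightarrow> nxt a i\<close>, \<open>i < l\<close>.\<close>

definition central_cycle :: "nat \<Rightarrow> 'a cquiver \<Rightarrow> 'a list \<Rightarrow> bool" where
  "central_cycle m Q a \<longleftrightarrow>
     induced_cycle m Q a \<and> (\<exists>h. 0 < h \<and> h < length a \<and> cycle_color Q a = h * m)"

definition cond_a :: "nat \<Rightarrow> 'a cquiver \<Rightarrow> 'a list \<Rightarrow> bool" where
  "cond_a m Q a \<longleftrightarrow>
     central_cycle m Q a \<and> (\<forall>b. central_cycle m Q b \<longrightarrow> set b = set a)"

definition cond_b :: "nat \<Rightarrow> 'a cquiver \<Rightarrow> 'a list \<Rightarrow> bool" where
  "cond_b m Q a \<longleftrightarrow>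
     (if length a = 2
      then (\<exists>c\<le>m. arr Q (a ! 0) (a ! 1) c = 2 \<and> arr Q (a ! 1) (a ! 0) (m - c) = 2) \<and>
           (\<forall>x y. x \<noteq> y \<and> {x, y} \<noteq> set a \<longrightarrow> mult m Q x y \<le> 1)
      else simple_quiver m Q)"

definition cond_c :: "nat \<Rightarrow> 'a cquiver \<Rightarrow> 'a list \<Rightarrow> bool" where
  "cond_c m Q a \<longleftrightarrow> (\<forall>S. hole m Q S \<longleftrightarrow> 4 \<le> length a \<and> S = set a)"

definition central_pair_cliques ::
    "nat \<Rightarrow> 'a cquiver \<Rightarrow> 'a list \<Rightarrow> 'a \<Rightarrow> 'a set \<Rightarrow> 'a set \<Rightarrow> bool" where
  "central_pair_cliques m Q a v C B \<longleftrightarrow>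
     clique_pair m Q v (set a) C B \<and>
     (\<forall>u\<in>C - set a. \<forall>w\<in>B - set a. \<not> neighbors Q u w)"

definition cond_d :: "nat \<Rightarrow> 'a cquiver \<Rightarrow> 'a list \<Rightarrow> bool" where
  "cond_d m Q a \<longleftrightarrow>
     (\<forall>v\<in>verts Q. nbrs Q v \<noteq> {} \<longrightarrow>
        (if length a = 2 \<and> v \<in> set a
         then \<exists>C B. central_pair_cliques m Q a v C B
         else \<exists>C B. clique_pair m Q v {v} C B \<and>
                (\<forall>u\<in>C - {v}. \<forall>w\<in>B - {v}.
                   \<not> (length a = 3 \<and> {u, v, w} = set a) \<longrightarrow> \<not> neighbors Q u w)))"

text \<open>For \<open>l = 3\<close> the central triangle is discarded before maximality is considered:
  otherwise \<open>D i\<close> could never be just the edge \<open>{a ! i, nxt a i}\<close>.\<close>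

definition edge_cliques :: "'a cquiver \<Rightarrow> 'a list \<Rightarrow> nat \<Rightarrow> 'a set set" where
  "edge_cliques Q a i =
     {K. clique Q K \<and> {a ! i, nxt a i} \<subseteq> K \<and> \<not> (length a = 3 \<and> K = set a)}"

definition max_edge_clique :: "'a cquiver \<Rightarrow> 'a list \<Rightarrow> nat \<Rightarrow> 'a set \<Rightarrow> bool" where
  "max_edge_clique Q a i K \<longleftrightarrow>
     K \<in> edge_cliques Q a i \<and> (\<forall>K'\<in>edge_cliques Q a i. K \<subseteq> K' \<longrightarrow> K' = K)"

text \<open>For \<open>l = 2\<close>, which of the two cliques is \<open>D 0\<close> is part of the data; it decides which of the
  two parallel edges is traversed \<open>a ! 0 \<rightarrow> a ! 1\<close>, and so the direction of the central cycle.\<close>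

definition cond_e :: "nat \<Rightarrow> 'a cquiver \<Rightarrow> 'a list \<Rightarrow> (nat \<Rightarrow> 'a set) \<Rightarrow> bool" where
  "cond_e m Q a D \<longleftrightarrow>
     (if length a = 2
      then \<forall>v\<in>set a. central_pair_cliques m Q a v (D 0) (D 1)
      else \<forall>i<length a.
             max_edge_clique Q a i (D i) \<and>
             (\<forall>K. max_edge_clique Q a i K \<longrightarrow> K = D i) \<and>
             card (D i) \<le> m + 2)"

definition cond_f :: "nat \<Rightarrow> 'a cquiver \<Rightarrow> 'a list \<Rightarrow> bool" where
  "cond_f m Q a \<longleftrightarrow>
     (\<forall>x y z. triangle Q x y z \<and> \<not> (length a = 3 \<and> {x, y, z} = set a) \<longrightarrow>
              admissible m Q x y z)"

definition peripheral :: "'a list \<Rightarrow> (nat \<Rightarrow> 'a set) \<Rightarrow> 'a set" where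
  "peripheral a D = (\<Union>i<length a. D i - {a ! i, nxt a i})"

definition W_color :: "'a cquiver \<Rightarrow> 'a list \<Rightarrow> (nat \<Rightarrow> 'a set) \<Rightarrow> nat \<Rightarrow> 'a set" where
  "W_color Q a D s =
     {w. \<exists>i<length a. w \<in> D i - {a ! i, nxt a i} \<and> cycle_color Q [a ! i, nxt a i, w] = s}"

definition Wp :: "nat \<Rightarrow> 'a cquiver \<Rightarrow> 'a list \<Rightarrow> (nat \<Rightarrow> 'a set) \<Rightarrow> 'a set" where
  "Wp m Q a D = W_color Q a D (m - 1)"

definition Wq :: "nat \<Rightarrow> 'a cquiver \<Rightarrow> 'a list \<Rightarrow> (nat \<Rightarrow> 'a set) \<Rightarrow> 'a set" where
  "Wq m Q a D = W_color Q a D (2 * m + 1)"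

text \<open>What is left of \<open>Q\<close> after removing all arrows of all \<open>D i\<close> and all central vertices.\<close>

definition residual :: "'a cquiver \<Rightarrow> 'a list \<Rightarrow> (nat \<Rightarrow> 'a set) \<Rightarrow> 'a cquiver" where
  "residual Q a D =
     \<lparr>verts = verts Q - set a,
      arr = (\<lambda>x y c. if x \<in> set a \<or> y \<in> set a \<or> (\<exists>i<length a. x \<in> D i \<and> y \<in> D i)
                     then 0 else arr Q x y c)\<rparr>"

definition component :: "'a cquiver \<Rightarrow> 'a \<Rightarrow> 'a cquiver" where
  "component Q w = induced Q {x. (w, x) \<in> (adj Q)\<^sup>*}"

text \<open>The quiver \<open>Q\<^sub>w\<close>; being the connected summand of the residual quiver that contains \<open>w\<close>,
  it is the connected component of \<open>w\<close>.\<close>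

definition Qw :: "'a cquiver \<Rightarrow> 'a list \<Rightarrow> (nat \<Rightarrow> 'a set) \<Rightarrow> 'a \<Rightarrow> 'a cquiver" where
  "Qw Q a D w = component (residual Q a D) w"

definition nw :: "'a cquiver \<Rightarrow> 'a list \<Rightarrow> (nat \<Rightarrow> 'a set) \<Rightarrow> 'a \<Rightarrow> nat" where
  "nw Q a D w = card (verts (Qw Q a D w))"

definition cond_g ::
    "nat \<Rightarrow> nat \<Rightarrow> nat \<Rightarrow> 'a cquiver \<Rightarrow> 'a list \<Rightarrow> (nat \<Rightarrow> 'a set) \<Rightarrow> bool" where
  "cond_g m p q Q a D \<longleftrightarrow>
     (\<forall>w\<in>peripheral a D. \<exists>!i. i < length a \<and> w \<in> D i) \<and>
     verts (residual Q a D) = (\<Union>w\<in>peripheral a D. verts (Qw Q a D w)) \<and>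
     (\<forall>w\<in>peripheral a D. \<forall>w'\<in>peripheral a D. w \<noteq> w' \<longrightarrow>
        verts (Qw Q a D w) \<inter> verts (Qw Q a D w') = {}) \<and>
     (\<forall>w\<in>peripheral a D. w \<in> verts (Qw Q a D w) \<and> Qw Q a D w \<in> Qn m (nw Q a D w)) \<and>
     (\<exists>h. 0 < h \<and> h < length a \<and> cycle_color Q a = h * m \<and>
          p = (length a - h) + (\<Sum>w\<in>Wp m Q a D. nw Q a D w) \<and>
          q = h + (\<Sum>w\<in>Wq m Q a D. nw Q a D w))"

text \<open>\<open>Q\<close> satisfies the defining conditions of \<open>\<Q>\<^sup>m\<^sub>p\<^sub>,\<^sub>q\<close>, and the direction given by \<open>a\<close>
  and \<open>D\<close> is the counterclockwise one, i.e. the last condition holds for it.\<close>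

definition ccw_structure ::
    "nat \<Rightarrow> nat \<Rightarrow> nat \<Rightarrow> 'a cquiver \<Rightarrow> 'a list \<Rightarrow> (nat \<Rightarrow> 'a set) \<Rightarrow> bool" where
  "ccw_structure m p q Q a D \<longleftrightarrow>
     colored_quiver m Q \<and> connected_quiver Q \<and> card (verts Q) = p + q \<and>
     cond_a m Q a \<and> cond_b m Q a \<and> cond_c m Q a \<and> cond_d m Q a \<and>
     cond_e m Q a D \<and> cond_f m Q a \<and> cond_g m p q Q a D"

definition Qpq :: "nat \<Rightarrow> nat \<Rightarrow> nat \<Rightarrow> 'a cquiver set" where
  "Qpq m p q = {Q. \<exists>a D. ccw_structure m p q Q a D}"

subsection \<open>The parameters for \<open>m = 1\<close>\<close>

text \<open>Arrows of color \<open>0\<close>, recorded by their end points. This loses multiplicities only for the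
  two parallel arrows between the central vertices when \<open>l = 2\<close>; these are told apart by the
  index of the central edge.\<close>

definition arrows0 :: "'a cquiver \<Rightarrow> ('a \<times> 'a) set" where
  "arrows0 Q = {(x, y). arr Q x y 0 \<noteq> 0}"

text \<open>An oriented 3-cycle is identified with the set of its three arrows.\<close>

definition oriented_3cycles :: "'a cquiver \<Rightarrow> ('a \<times> 'a) set set" where
  "oriented_3cycles Q =
     {{(x, y), (y, z), (z, x)} | x y z.
        distinct [x, y, z] \<and> (x, y) \<in> arrows0 Q \<and> (y, z) \<in> arrows0 Q \<and> (z, x) \<in> arrows0 Q}"

definition ccw_edges :: "'a cquiver \<Rightarrow> 'a list \<Rightarrow> nat set" where
  "ccw_edges Q a = {i. i < length a \<and> col Q (a ! i) (nxt a i) = 0}"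

definition cw_edges :: "'a cquiver \<Rightarrow> 'a list \<Rightarrow> nat set" where
  "cw_edges Q a = {i. i < length a \<and> col Q (a ! i) (nxt a i) = 1}"

definition central_arrow :: "'a cquiver \<Rightarrow> 'a list \<Rightarrow> nat \<Rightarrow> 'a \<times> 'a" where
  "central_arrow Q a i =
     (if col Q (a ! i) (nxt a i) = 0 then (a ! i, nxt a i) else (nxt a i, a ! i))"

text \<open>The oriented 3-cycles containing the color \<open>0\<close> arrow on the \<open>i\<close>-th central edge. For
  \<open>l = 2\<close> that edge belongs to \<open>D i\<close> and is used only by the 3-cycles inside \<open>D i\<close>.\<close>

definition central_3cycles ::
    "'a cquiver \<Rightarrow> 'a list \<Rightarrow> (nat \<Rightarrow> 'a set) \<Rightarrow> nat \<Rightarrow> ('a \<times> 'a) set set" where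
  "central_3cycles Q a D i =
     {T \<in> oriented_3cycles Q. central_arrow Q a i \<in> T \<and> (length a = 2 \<longrightarrow> Field T \<subseteq> D i)}"

definition r1' :: "'a cquiver \<Rightarrow> 'a list \<Rightarrow> (nat \<Rightarrow> 'a set) \<Rightarrow> nat" where
  "r1' Q a D = card {i \<in> ccw_edges Q a. central_3cycles Q a D i = {}}"

definition r2' :: "'a cquiver \<Rightarrow> 'a list \<Rightarrow> (nat \<Rightarrow> 'a set) \<Rightarrow> nat" where
  "r2' Q a D = card (\<Union>i\<in>ccw_edges Q a. central_3cycles Q a D i)"

definition s1' :: "'a cquiver \<Rightarrow> 'a list \<Rightarrow> (nat \<Rightarrow> 'a set) \<Rightarrow> nat" where
  "s1' Q a D = card {i \<in> cw_edges Q a. central_3cycles Q a D i = {}}"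

definition s2' :: "'a cquiver \<Rightarrow> 'a list \<Rightarrow> (nat \<Rightarrow> 'a set) \<Rightarrow> nat" where
  "s2' Q a D = card (\<Union>i\<in>cw_edges Q a. central_3cycles Q a D i)"

definition free_arrows :: "'a cquiver \<Rightarrow> ('a \<times> 'a) set" where
  "free_arrows Q = {\<alpha> \<in> arrows0 Q. \<forall>T\<in>oriented_3cycles Q. \<alpha> \<notin> T}"

definition r1'' :: "'a cquiver \<Rightarrow> 'a list \<Rightarrow> (nat \<Rightarrow> 'a set) \<Rightarrow> nat" where
  "r1'' Q a D = (\<Sum>w\<in>Wp 1 Q a D. card (free_arrows (Qw Q a D w)))"

definition r2'' :: "'a cquiver \<Rightarrow> 'a list \<Rightarrow> (nat \<Rightarrow> 'a set) \<Rightarrow> nat" where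
  "r2'' Q a D = (\<Sum>w\<in>Wp 1 Q a D. card (oriented_3cycles (Qw Q a D w)))"

definition s1'' :: "'a cquiver \<Rightarrow> 'a list \<Rightarrow> (nat \<Rightarrow> 'a set) \<Rightarrow> nat" where
  "s1'' Q a D = (\<Sum>w\<in>Wq 1 Q a D. card (free_arrows (Qw Q a D w)))"

definition s2'' :: "'a cquiver \<Rightarrow> 'a list \<Rightarrow> (nat \<Rightarrow> 'a set) \<Rightarrow> nat" where
  "s2'' Q a D = (\<Sum>w\<in>Wq 1 Q a D. card (oriented_3cycles (Qw Q a D w)))"

end

theory Submission
  imports Defs
begin

text \<open>A quiver in \<open>\<Q>\<^sup>1\<^sub>n\<close> is a tree of edges and oriented 3-cycles. Indeed, grow a connected vertex
  set \<open>S\<close> by one vertex \<open>v\<close> adjacent to \<open>S\<close> at a time: the neighbors of \<open>v\<close> in \<open>S\<close> form a clique, since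
  a shortest path in \<open>S\<close> between two nonadjacent ones would close up with \<open>v\<close> to a hole, and this
  clique has at most two elements because every edge lies in at most one triangle. So
  vertices minus edges plus triangles stays \<open>1\<close>, which gives
  \<open>n = 1 + free arrows + 2 * (oriented 3-cycles)\<close>. Applied to each \<open>Q\<^sub>w\<close>, the summand \<open>1\<close> is the
  peripheral vertex \<open>w\<close>, and it is accounted for by the unique oriented 3-cycle on the corresponding
  central arrow, whose direction decides between \<open>W\<^sub>p\<close> and \<open>W\<^sub>q\<close>.\<close>

subsection \<open>Arrows of color 0\<close>

lemma mem_nbrs: "u \<in> nbrs Q v \<longleftrightarrow> neighbors Q v u"
  by (simp add: nbrs_def)

lemma finite_verts: "colored_quiver m Q \<Longrightarrow> finite (verts Q)"
  unfolding colored_quiver_def by (elim conjE)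

lemma arr_flip:
  assumes "colored_quiver m Q" "c \<le> m"
  shows "arr Q x y c = arr Q y x (m - c)"
proof -
  have "\<forall>i j c. c \<le> m \<longrightarrow> arr Q i j c = arr Q j i (m - c)"
    using assms(1) unfolding colored_quiver_def by (elim conjE)
  then show ?thesis using assms(2) by blast
qed

lemma arr_bounds:
  assumes "colored_quiver m Q" "arr Q x y c \<noteq> 0"
  shows "x \<in> verts Q" "y \<in> verts Q" "c \<le> m" "x \<noteq> y"
proof -
  have *: "\<forall>i j c. arr Q i j c \<noteq> 0 \<longrightarrow> i \<in> verts Q \<and> j \<in> verts Q \<and> c \<le> m"
    using assms(1) unfolding colored_quiver_def by (elim conjE)
  have **: "\<forall>i c. arr Q i i c = 0"
    using assms(1) unfolding colored_quiver_def by (elim conjE)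
  show "x \<in> verts Q" "y \<in> verts Q" "c \<le> m" using * assms(2) by blast+
  show "x \<noteq> y" using ** assms(2) by auto
qed

lemma arr_color_unique:
  assumes "colored_quiver m Q" "arr Q x y c \<noteq> 0" "arr Q x y c' \<noteq> 0"
  shows "c' = c"
proof -
  have "\<forall>i j c c'. arr Q i j c \<noteq> 0 \<and> c' \<noteq> c \<longrightarrow> arr Q i j c' = 0"
    using assms(1) unfolding colored_quiver_def by (elim conjE)
  then show ?thesis using assms(2,3) by metis
qed

lemma neighbors_sym:
  assumes "colored_quiver m Q" "neighbors Q x y"
  shows "neighbors Q y x"
proof -
  obtain c where c: "arr Q x y c \<noteq> 0" using assms(2) by (auto simp: neighbors_def)
  then have "arr Q y x (m - c) \<noteq> 0"
    using arr_flip[OF assms(1)] arr_bounds(3)[OF assms(1) c] by metis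
  then show ?thesis by (auto simp: neighbors_def)
qed

lemma neighbors_verts:
  assumes "colored_quiver m Q" "neighbors Q x y"
  shows "x \<in> verts Q" "y \<in> verts Q" "x \<noteq> y"
  using arr_bounds[OF assms(1)] assms(2) unfolding neighbors_def by blast+

lemma col_eqI:
  assumes "colored_quiver m Q" "arr Q x y c \<noteq> 0"
  shows "col Q x y = c"
  unfolding col_def using assms arr_color_unique[OF assms(1)] by (intro the_equality) blast+

lemma arrows0_flip:
  assumes "colored_quiver 1 Q"
  shows "(y, x) \<in> arrows0 Q \<longleftrightarrow> arr Q x y 1 \<noteq> 0"
proof -
  have "arr Q x y 1 = arr Q y x 0"
    using arr_flip[OF assms, of 1] by simp
  then show ?thesis by (simp add: arrows0_def)
qed

lemma neighbors_iff_arrows0: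
  assumes "colored_quiver 1 Q"
  shows "neighbors Q x y \<longleftrightarrow> (x, y) \<in> arrows0 Q \<or> (y, x) \<in> arrows0 Q"
proof -
  have "c \<le> 1" if "arr Q x y c \<noteq> 0" for c
    using arr_bounds(3)[OF assms that] .
  then have "neighbors Q x y \<longleftrightarrow> arr Q x y 0 \<noteq> 0 \<or> arr Q x y 1 \<noteq> 0"
    unfolding neighbors_def by (metis le_eq_less_or_eq less_one)
  then show ?thesis using arrows0_flip[OF assms, of y x] by (simp add: arrows0_def)
qed

lemma arrows0_asym:
  assumes "colored_quiver 1 Q" "(x, y) \<in> arrows0 Q"
  shows "(y, x) \<notin> arrows0 Q"
  using arr_color_unique[OF assms(1), of x y 0 1] assms(2) arrows0_flip[OF assms(1)]
  by (auto simp: arrows0_def)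

lemma col_eq_0:
  assumes "colored_quiver 1 Q" "(x, y) \<in> arrows0 Q"
  shows "col Q x y = 0"
  by (rule col_eqI[OF assms(1)]) (use assms(2) in \<open>simp add: arrows0_def\<close>)

lemma col_eq_1:
  assumes "colored_quiver 1 Q" "(y, x) \<in> arrows0 Q"
  shows "col Q x y = 1"
  by (rule col_eqI[OF assms(1)]) (use assms(2) arrows0_flip[OF assms(1)] in simp)

lemma neighbors_col_cases:
  assumes "colored_quiver 1 Q" "neighbors Q x y"
  obtains "(x, y) \<in> arrows0 Q" "col Q x y = 0" | "(y, x) \<in> arrows0 Q" "col Q x y = 1"
  using assms(2) col_eq_0[OF assms(1), of x y] col_eq_1[OF assms(1), of y x] that
  unfolding neighbors_iff_arrows0[OF assms(1)] by argo

lemma cycle_color_triple: "cycle_color Q [x, y, z] = col Q x y + col Q y z + col Q z x"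
proof -
  have "{..<length [x, y, z]} = {0, 1, 2}" by auto
  then show ?thesis unfolding cycle_color_def nxt_def by (simp add: add.assoc)
qed

lemma triangleI:
  assumes "colored_quiver m Q" "neighbors Q x y" "neighbors Q y z" "neighbors Q z x"
  shows "triangle Q x y z"
  using neighbors_verts[OF assms(1,2)] neighbors_verts[OF assms(1,3)] neighbors_verts[OF assms(1,4)]
    neighbors_sym[OF assms(1,2)] neighbors_sym[OF assms(1,3)] neighbors_sym[OF assms(1,4)] assms(2-4)
  by (simp add: triangle_def clique_def)

lemma triangle_neighbors:
  assumes "triangle Q x y z"
  shows "neighbors Q x y" "neighbors Q y z" "neighbors Q z x"
  using assms unfolding triangle_def clique_def by auto

text \<open>For \<open>m = 1\<close> the admissible sums are 0 and 3, while each of the three colors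
  is 0 or 1, so all three agree: the color 0 arrows run all along \<open>(x y z)\<close> or all
  against it. The color of the first edge alone decides which.\<close>

lemma admissible_oriented:
  assumes cq: "colored_quiver 1 Q" and t: "triangle Q x y z" and ad: "admissible 1 Q x y z"
  obtains "(x, y) \<in> arrows0 Q" "(y, z) \<in> arrows0 Q" "(z, x) \<in> arrows0 Q"
      "cycle_color Q [x, y, z] = 0" "col Q x y = 0"
  | "(y, x) \<in> arrows0 Q" "(x, z) \<in> arrows0 Q" "(z, y) \<in> arrows0 Q"
      "cycle_color Q [x, y, z] = 3" "col Q x y = 1"
proof -
  have s: "col Q x y + col Q y z + col Q z x = 0 \<or> col Q x y + col Q y z + col Q z x = 3"
    using ad by (simp add: admissible_def cycle_color_triple)
  have "(u, v) \<in> arrows0 Q \<and> col Q u v = 0 \<or> (v, u) \<in> arrows0 Q \<and> col Q u v = 1"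
    if "neighbors Q u v" for u v
    using neighbors_col_cases[OF cq that] by metis
  from this[OF triangle_neighbors(1)[OF t]] this[OF triangle_neighbors(2)[OF t]]
    this[OF triangle_neighbors(3)[OF t]] s
  have "(x, y) \<in> arrows0 Q \<and> (y, z) \<in> arrows0 Q \<and> (z, x) \<in> arrows0 Q \<and>
      cycle_color Q [x, y, z] = 0 \<and> col Q x y = 0 \<or>
    (y, x) \<in> arrows0 Q \<and> (x, z) \<in> arrows0 Q \<and> (z, y) \<in> arrows0 Q \<and>
      cycle_color Q [x, y, z] = 3 \<and> col Q x y = 1"
    unfolding cycle_color_triple by (elim disjE conjE) simp_all
  then show ?thesis using that by blast
qed

subsection \<open>Oriented 3-cycles\<close>

definition cyc3 :: "'a \<Rightarrow> 'a \<Rightarrow> 'a \<Rightarrow> ('a \<times> 'a) set" where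
  "cyc3 x y z = {(x, y), (y, z), (z, x)}"

lemma cyc3_rotate: "cyc3 x y z = cyc3 y z x"
  by (auto simp: cyc3_def)

lemma Field_cyc3 [simp]: "Field (cyc3 x y z) = {x, y, z}"
  by (auto simp: cyc3_def Field_def)

lemma card_cyc3: "distinct [x, y, z] \<Longrightarrow> card (cyc3 x y z) = 3"
  by (simp add: cyc3_def)

lemma oriented_3cyclesI:
  assumes "colored_quiver 1 Q"
    and "(x, y) \<in> arrows0 Q" "(y, z) \<in> arrows0 Q" "(z, x) \<in> arrows0 Q"
  shows "cyc3 x y z \<in> oriented_3cycles Q"
proof -
  have "distinct [x, y, z]"
    using arrows0_asym[OF assms(1)] assms(2-4) by auto
  then show ?thesis using assms(2-4) unfolding oriented_3cycles_def cyc3_def by blast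
qed

text \<open>Rotation puts any chosen arrow of the cycle first. Hence a 3-cycle through a given arrow
  is determined by its third vertex, which is the form used by the uniqueness arguments
  below.\<close>

lemma oriented_3cycles_at_arrow:
  assumes "T \<in> oriented_3cycles Q" "(x, y) \<in> T"
  obtains z where "T = cyc3 x y z" "distinct [x, y, z]"
    "(x, y) \<in> arrows0 Q" "(y, z) \<in> arrows0 Q" "(z, x) \<in> arrows0 Q"
proof -
  obtain a b c where abc: "T = cyc3 a b c" "distinct [a, b, c]" "(a, b) \<in> arrows0 Q"
      "(b, c) \<in> arrows0 Q" "(c, a) \<in> arrows0 Q"
    using assms(1) unfolding oriented_3cycles_def cyc3_def by blast
  consider "x = a" "y = b" | "x = b" "y = c" | "x = c" "y = a"
    using assms(2) abc(1) by (auto simp: cyc3_def)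
  then show ?thesis
  proof cases
    case 1 then show ?thesis using abc that[of c] by simp
  next
    case 2
    show ?thesis by (rule that[of a]) (use 2 abc cyc3_rotate[of a b c] in auto)
  next
    case 3
    show ?thesis by (rule that[of b]) (use 3 abc cyc3_rotate[of c a b] in auto)
  qed
qed

lemma oriented_3cycles_nonempty:
  assumes "T \<in> oriented_3cycles Q"
  obtains x y where "(x, y) \<in> T"
  using assms unfolding oriented_3cycles_def by auto

lemma oriented_3cycles_subset: "T \<in> oriented_3cycles Q \<Longrightarrow> T \<subseteq> arrows0 Q"
  unfolding oriented_3cycles_def by blast

lemma finite_arrows0:
  assumes "colored_quiver m Q"
  shows "finite (arrows0 Q)"
proof -
  have "arrows0 Q \<subseteq> verts Q \<times> verts Q"
    using arr_bounds[OF assms] by (auto simp: arrows0_def)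
  then show ?thesis using finite_verts[OF assms] finite_subset by blast
qed

lemma finite_oriented_3cycles:
  assumes "colored_quiver m Q"
  shows "finite (oriented_3cycles Q)"
  by (rule finite_subset[of _ "Pow (arrows0 Q)"])
    (use oriented_3cycles_subset finite_arrows0[OF assms] in auto)

subsection \<open>Counting in the class \<open>\<Q>\<^sup>1\<^sub>n\<close>\<close>

text \<open>Seen from \<open>x\<close>, the vertices \<open>z\<close> and \<open>w\<close> are
  adjacent to \<open>y\<close>, and no arrows join the two cliques at \<open>x\<close> away from
  \<open>x\<close>. So all three lie in the same clique, which together with \<open>x\<close> would
  have four elements, more than \<open>m + 2 = 3\<close>.\<close>

lemma Qn_edge_in_one_triangle:
  assumes Q: "Q \<in> Qn 1 n"
    and xy: "neighbors Q x y"
    and z: "neighbors Q x z" "neighbors Q y z"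
    and w: "neighbors Q x w" "neighbors Q y w"
  shows "z = w"
proof (rule ccontr)
  assume "z \<noteq> w"
  have cq: "colored_quiver 1 Q" using Q by (simp add: Qn_def)
  note nb = neighbors_verts[OF cq] and sy = neighbors_sym[OF cq]
  have "x \<in> verts Q" "nbrs Q x \<noteq> {}" using nb xy by (auto simp: mem_nbrs)
  then obtain C B where cp: "clique_pair 1 Q x {x} C B"
    and no: "\<forall>u\<in>C - {x}. \<forall>w\<in>B - {x}. \<not> neighbors Q u w"
    using Q unfolding Qn_def by blast
  have card4: "card {x, y, z, w} = 4"
    using nb(3) xy z w \<open>z \<noteq> w\<close> by (auto simp: card_insert_if)
  have un: "C \<union> B = insert x (nbrs Q x)" and ca: "card C \<in> {1..3}" "card B \<in> {1..3}"
    using cp by (auto simp: clique_pair_def numeral_3_eq_3)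
  have mem: "y \<in> C \<union> B" "z \<in> C \<union> B" "w \<in> C \<union> B" "x \<in> C \<inter> B"
    using un xy z w cp by (auto simp: mem_nbrs clique_pair_def)
  have ne: "y \<noteq> x" "z \<noteq> x" "w \<noteq> x" using nb(3) xy z w by blast+
  \<comment> \<open>The side containing \<open>y\<close> attracts its neighbors \<open>z\<close> and
    \<open>w\<close>.\<close>
  have "{x, y, z, w} \<subseteq> C \<or> {x, y, z, w} \<subseteq> B"
  proof (cases "y \<in> C")
    case True
    then have "z \<in> C" "w \<in> C" using no mem ne z w by blast+
    then show ?thesis using True mem by blast
  next
    case False
    then have "y \<in> B" using mem by blast
    then have "z \<in> B" "w \<in> B" using no mem ne sy z w by blast+
    then show ?thesis using \<open>y \<in> B\<close> mem by blast
  qed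
  moreover have "finite C" "finite B" using ca by (auto intro: card_ge_0_finite)
  ultimately have "card C \<ge> 4 \<or> card B \<ge> 4" using card4 card_mono by metis
  then show False using ca by auto
qed

section \<open>Shortest paths and holes\<close>

lemma mult_simple_quiver:
  assumes "colored_quiver m Q" "simple_quiver m Q"
  shows "mult m Q x y = (if neighbors Q x y then 1 else 0)"
proof (cases "neighbors Q x y")
  case True
  then obtain c where c: "arr Q x y c \<noteq> 0" by (auto simp: neighbors_def)
  then have "c \<le> m" "x \<noteq> y" using arr_bounds[OF assms(1)] by blast+
  then have "mult m Q x y \<ge> arr Q x y c"
    unfolding mult_def by (intro member_le_sum) auto
  moreover have "mult m Q x y \<le> 1" using assms(2) \<open>x \<noteq> y\<close> by (auto simp: simple_quiver_def)
  ultimately show ?thesis using True c by simp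
next
  case False
  then show ?thesis by (simp add: mult_def neighbors_def)
qed

text \<open>Reflexive transitive closure and powers of this relation speak of walks that stay inside
  \<open>S\<close>, so connectedness of \<open>S\<close> and path lengths in \<open>S\<close> need
  no induced quiver.\<close>

definition restr :: "'a cquiver \<Rightarrow> 'a set \<Rightarrow> ('a \<times> 'a) set" where
  "restr Q S = adj Q \<inter> S \<times> S"

lemma relpow_segment:
  assumes "\<forall>i<n. (f i, f (Suc i)) \<in> R" "i \<le> j" "j \<le> n"
  shows "(f i, f j) \<in> R ^^ (j - i)"
  unfolding relpow_fun_conv
  by (rule exI[of _ "\<lambda>t. f (i + t)"]) (use assms in auto)

text \<open>A chordless path whose end points are its only vertices adjacent to \<open>v\<close>
  closes up through \<open>v\<close> to an induced cycle on \<open>k + 2\<close> vertices;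
  \<open>2 \<le> k\<close> makes these at least four.\<close>

lemma hole_from_path:
  assumes cq: "colored_quiver m Q" and simple: "simple_quiver m Q"
    and k: "2 \<le> k" and v: "v \<in> verts Q" and f: "\<And>i. i \<le> k \<Longrightarrow> f i \<in> verts Q"
    and adj: "\<And>i j. i \<le> k \<Longrightarrow> j \<le> k \<Longrightarrow> neighbors Q (f i) (f j) \<longleftrightarrow> j = Suc i \<or> i = Suc j"
    and inj: "\<And>i j. i \<le> k \<Longrightarrow> j \<le> k \<Longrightarrow> f i = f j \<Longrightarrow> i = j"
    and vf: "\<And>i. i \<le> k \<Longrightarrow> neighbors Q v (f i) \<longleftrightarrow> i = 0 \<or> i = k"
    and vn: "\<And>i. i \<le> k \<Longrightarrow> f i \<noteq> v"
  shows "\<exists>S. hole m Q S"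
proof -
  define xs where "xs = v # map f [0..<Suc k]"
  have len: "length xs = k + 2" by (simp add: xs_def)
  have x0: "xs ! 0 = v" by (simp add: xs_def)
  have xS: "xs ! Suc t = f t" if "t \<le> k" for t
    using that unfolding xs_def by (simp del: upt_Suc add: nth_map)
  have "inj_on f {0..<Suc k}" using inj by (auto simp: inj_on_def)
  moreover have "v \<notin> f ` {0..<Suc k}"
    using vn by (metis atLeastLessThan_iff imageE less_Suc_eq_le)
  ultimately have dist: "distinct xs"
    unfolding xs_def by (simp add: distinct_map del: upt_Suc)
  have fv: "neighbors Q (f i) v \<longleftrightarrow> i = 0 \<or> i = k" if "i \<le> k" for i
    using vf[OF that] neighbors_sym[OF cq] by blast
  have vv: "\<not> neighbors Q v v" using neighbors_verts(3)[OF cq] by blast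
  have "induced_cycle m Q xs"
    unfolding induced_cycle_def
  proof (intro conjI allI impI)
    show "2 \<le> length xs" using len by simp
    show "distinct xs" by fact
    show "set xs \<subseteq> verts Q" using v f unfolding xs_def by (auto simp del: upt_Suc)
    fix i j assume ij: "i < length xs" "j < length xs"
    \<comment> \<open>The path vertex \<open>f t\<close> sits at index \<open>Suc t\<close>, so only
      the last index \<open>Suc k\<close> wraps around, and it wraps to \<open>v\<close> at index
      0.\<close>
    have md: "Suc t mod length xs = (if t = Suc k then 0 else Suc t)" if "t < length xs" for t
      using that len by auto
    show "mult m Q (xs ! i) (xs ! j) =
       (if j = Suc i mod length xs then 1 else 0) + (if i = Suc j mod length xs then 1 else 0)"
      unfolding mult_simple_quiver[OF cq simple] md[OF ij(1)] md[OF ij(2)]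
      using ij len k
      by (cases i; cases j) (auto simp: x0 xS vf fv vv adj)
  qed
  moreover have "4 \<le> card (set xs)"
    using distinct_card[OF dist] len k by simp
  ultimately show ?thesis unfolding hole_def by blast
qed

text \<open>Otherwise a shortest path in \<open>S\<close> between two nonadjacent neighbors of
  \<open>v\<close> would be chordless and meet the neighborhood of \<open>v\<close> only in its
  ends, so it would close up with \<open>v\<close> to a hole.\<close>

lemma Qn_neighbors_in_connected_set:
  assumes Q: "Q \<in> Qn 1 n"
    and S: "S \<subseteq> verts Q" and con: "\<forall>x\<in>S. \<forall>y\<in>S. (x, y) \<in> (restr Q S)\<^sup>*"
    and v: "v \<notin> S" and u: "u \<in> S" "neighbors Q v u" and w: "w \<in> S" "neighbors Q v w"
    and uw: "u \<noteq> w"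
  shows "neighbors Q u w"
proof (rule ccontr)
  assume nuw: "\<not> neighbors Q u w"
  have cq: "colored_quiver 1 Q" and sq: "simple_quiver 1 Q" and nohole: "\<nexists>S. hole 1 Q S"
    using Q by (auto simp: Qn_def)
  note nb = neighbors_verts[OF cq] and sy = neighbors_sym[OF cq]
  \<comment> \<open>The minimum is taken over all nonadjacent pairs of neighbors of \<open>v\<close>
    in \<open>S\<close>, not only the given pair; this is what allows passing to another pair when
    an inner vertex is adjacent to \<open>v\<close>.\<close>
  define P where "P k \<longleftrightarrow> (\<exists>u w. u \<in> S \<and> w \<in> S \<and> neighbors Q v u \<and> neighbors Q v w \<and>
      u \<noteq> w \<and> \<not> neighbors Q u w \<and> (u, w) \<in> restr Q S ^^ k)" for k
  have "\<exists>k. P k"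
    using con u w uw nuw unfolding P_def rtrancl_power by blast
  define k where "k = (LEAST k. P k)"
  have Pk: "P k" and least: "\<And>j. P j \<Longrightarrow> k \<le> j"
    using \<open>\<exists>k. P k\<close> unfolding k_def by (auto intro: LeastI Least_le)
  obtain u w where u: "u \<in> S" "neighbors Q v u" and w: "w \<in> S" "neighbors Q v w"
    and uw: "u \<noteq> w" and nuw: "\<not> neighbors Q u w" and "(u, w) \<in> restr Q S ^^ k"
    using Pk unfolding P_def by blast
  then obtain f where f0: "f 0 = u" and fk: "f k = w"
    and step: "\<forall>i<k. (f i, f (Suc i)) \<in> restr Q S"
    unfolding relpow_fun_conv by blast
  have k1: "k \<noteq> 0" using f0 fk uw by metis
  have fS: "f i \<in> S" if "i \<le> k" for i
  proof (cases "i < k")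
    case True then show ?thesis using step by (auto simp: restr_def)
  next
    case False then show ?thesis using that fk w by simp
  qed
  have le: "k \<le> j" if "(u, w) \<in> restr Q S ^^ j" for j
    using least that u w uw nuw unfolding P_def by blast
  have k2: "2 \<le> k"
  proof (rule ccontr)
    assume "\<not> 2 \<le> k"
    then have "k = 1" using k1 by simp
    then have "(u, w) \<in> adj Q" using step f0 fk by (auto simp: restr_def)
    then show False using nuw by (simp add: adj_def)
  qed
  \<comment> \<open>Replacing the stretch from \<open>f i\<close> to \<open>f j\<close> by
    \<open>d\<close> steps cannot shorten the path. The case \<open>d = 0\<close> gives injectivity
    and \<open>d = 1\<close> excludes chords.\<close>
  have short: "j \<le> i + d" if "i \<le> j" "j \<le> k" "(f i, f j) \<in> restr Q S ^^ d" for i j d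
  proof -
    have "(f 0, f i) \<in> restr Q S ^^ i" "(f j, f k) \<in> restr Q S ^^ (k - j)"
      using relpow_segment[OF step, of 0 i] relpow_segment[OF step, of j k] that by auto
    then have "(u, w) \<in> restr Q S ^^ (i + d + (k - j))"
      using that(3) f0 fk by (metis relpow_trans)
    then show ?thesis using le that(1,2) by fastforce
  qed
  have inj': "i = j" if "i \<le> j" "j \<le> k" "f i = f j" for i j
    using short[OF that(1,2), of 0] that by simp
  have adj': "j = Suc i" if "i \<le> j" "j \<le> k" "neighbors Q (f i) (f j)" for i j
  proof -
    have "(f i, f j) \<in> restr Q S ^^ 1"
      using that fS by (auto simp: restr_def adj_def)
    then have "j \<le> Suc i" using short[OF that(1,2)] by fastforce
    moreover have "i \<noteq> j" using that(3) nb(3) by blast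
    ultimately show ?thesis using that(1) by simp
  qed
  have fadj: "neighbors Q (f i) (f (Suc i))" if "i < k" for i
    using step that by (auto simp: restr_def adj_def)
  \<comment> \<open>An inner vertex \<open>f i\<close> adjacent to \<open>v\<close> would form with
    \<open>u\<close> and with \<open>w\<close> pairs joined by shorter paths. By minimality both
    pairs are adjacent, and then the edge between \<open>v\<close> and \<open>f i\<close> lies in
    two triangles.\<close>
  have inner: "i = 0 \<or> i = k" if "i \<le> k" "neighbors Q v (f i)" for i
  proof (rule ccontr)
    assume "\<not> (i = 0 \<or> i = k)"
    then have i: "0 < i" "i < k" using that by auto
    have "(u, f i) \<in> restr Q S ^^ i" "(f i, w) \<in> restr Q S ^^ (k - i)"
      using relpow_segment[OF step, of 0 i] relpow_segment[OF step, of i k] f0 fk i by auto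
    moreover have "u \<noteq> f i" "f i \<noteq> w" using inj'[of 0 i] inj'[of i k] f0 fk i by auto
    moreover have "\<not> P i" "\<not> P (k - i)" using least i by fastforce+
    ultimately have "neighbors Q u (f i)" "neighbors Q (f i) w"
      using u w that fS[OF that(1)] unfolding P_def by blast+
    then show False
      using Qn_edge_in_one_triangle[OF Q that(2) u(2) _ w(2)] sy uw by blast
  qed
  have "\<exists>S. hole 1 Q S"
  proof (rule hole_from_path[OF cq sq k2, of v f])
    show "v \<in> verts Q" using nb u by blast
    show "f i \<in> verts Q" if "i \<le> k" for i using fS[OF that] S by blast
    show "neighbors Q (f i) (f j) \<longleftrightarrow> j = Suc i \<or> i = Suc j" if "i \<le> k" "j \<le> k" for i j
      using that adj'[of i j] adj'[of j i] fadj[of i] fadj[of j] sy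
      by (metis Suc_le_lessD linear)
    show "i = j" if "i \<le> k" "j \<le> k" "f i = f j" for i j
      using that inj'[of i j] inj'[of j i] by (metis linear)
    show "neighbors Q v (f i) \<longleftrightarrow> i = 0 \<or> i = k" if "i \<le> k" for i
      using inner[OF that] f0 fk u w by blast
    show "f i \<noteq> v" if "i \<le> k" for i using fS[OF that] v by blast
  qed
  then show False using nohole by blast
qed

section \<open>The Euler count, adding one vertex at a time\<close>

definition arrows_in :: "'a cquiver \<Rightarrow> 'a set \<Rightarrow> ('a \<times> 'a) set" where
  "arrows_in Q S = arrows0 Q \<inter> S \<times> S"

definition cycles_in :: "'a cquiver \<Rightarrow> 'a set \<Rightarrow> ('a \<times> 'a) set set" where
  "cycles_in Q S = {T \<in> oriented_3cycles Q. T \<subseteq> S \<times> S}"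

text \<open>A 3-cycle that appears only after adding \<open>v\<close> must pass through
  \<open>v\<close>, so it can be rotated to start there.\<close>

lemma cycles_in_insert:
  assumes T: "T \<in> cycles_in Q (insert v S)" "T \<notin> cycles_in Q S" and cq: "colored_quiver 1 Q"
  obtains y z where "T = cyc3 v y z" "y \<in> S" "z \<in> S" "y \<noteq> z" "(v, y) \<in> arrows0 Q"
    "(y, z) \<in> arrows0 Q" "(z, v) \<in> arrows0 Q"
proof -
  have To: "T \<in> oriented_3cycles Q" and Ts: "T \<subseteq> insert v S \<times> insert v S"
    using T(1) by (auto simp: cycles_in_def)
  have "\<not> T \<subseteq> S \<times> S" using T(2) To by (auto simp: cycles_in_def)
  then obtain x y where xy: "(x, y) \<in> T" "x = v \<or> y = v" using Ts by blast
  obtain z where z: "T = cyc3 x y z" "distinct [x, y, z]"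
    "(x, y) \<in> arrows0 Q" "(y, z) \<in> arrows0 Q" "(z, x) \<in> arrows0 Q"
    using oriented_3cycles_at_arrow[OF To xy(1)] by blast
  show ?thesis
  proof (cases "x = v")
    case True
    then show ?thesis using that[of y z] z Ts by (auto simp: cyc3_def)
  next
    case False
    then have "y = v" using xy by blast
    then show ?thesis
      using that[of z x] z Ts cyc3_rotate[of x y z] by (auto simp: cyc3_def)
  qed
qed

text \<open>The new vertex has one or two neighbors in \<open>S\<close>. With one neighbor, one
  vertex and one arrow are gained and no 3-cycle; with two, one vertex, two arrows and exactly one
  3-cycle. Both sides of the equation grow equally in either case.\<close>

lemma Qn_grow_count:
  assumes Q: "Q \<in> Qn 1 n"
    and S: "S \<subseteq> verts Q" and con: "\<forall>x\<in>S. \<forall>y\<in>S. (x, y) \<in> (restr Q S)\<^sup>*"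
    and v: "v \<notin> S" and u: "u \<in> S" "neighbors Q v u"
    and count: "card S + card (cycles_in Q S) = 1 + card (arrows_in Q S)"
  shows "card (insert v S) + card (cycles_in Q (insert v S)) = 1 + card (arrows_in Q (insert v S))"
proof -
  have cq: "colored_quiver 1 Q" using Q by (simp add: Qn_def)
  note sy = neighbors_sym[OF cq]
    and ni = neighbors_iff_arrows0[OF cq] and asy = arrows0_asym[OF cq]
  have finS: "finite S" using finite_subset[OF S finite_verts[OF cq]] .
  have cS: "card (insert v S) = Suc (card S)" using finS v by simp
  have finA: "finite (arrows_in Q X)" and finC: "finite (cycles_in Q X)" for X
    using finite_arrows0[OF cq] finite_oriented_3cycles[OF cq]
    by (auto simp: arrows_in_def cycles_in_def)
  have vv: "(v, v) \<notin> arrows0 Q" using asy by blast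
  have subA: "arrows_in Q S \<subseteq> arrows_in Q (insert v S)"
    and subC: "cycles_in Q S \<subseteq> cycles_in Q (insert v S)"
    by (auto simp: arrows_in_def cycles_in_def)
  have out: "neighbors Q v x" if "(v, x) \<in> arrows0 Q \<or> (x, v) \<in> arrows0 Q" for x
    using that ni[of v x] by simp
  \<comment> \<open>Each edge carries its color 0 arrow in exactly one direction; \<open>e\<close>
    is that arrow, whichever way it points.\<close>
  have edge: "\<exists>e. e \<in> {(v, x), (x, v)} \<and> e \<in> arrows0 Q \<and>
      (\<forall>b\<in>arrows0 Q. b = (v, x) \<or> b = (x, v) \<longrightarrow> b = e)"
    if "neighbors Q v x" for x
  proof (cases "(v, x) \<in> arrows0 Q")
    case True
    then show ?thesis using asy[OF True] by (intro exI[of _ "(v, x)"]) auto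
  next
    case False
    then show ?thesis using ni[of v x] that by (intro exI[of _ "(x, v)"]) auto
  qed
  note clq = Qn_neighbors_in_connected_set[OF Q S con v]
  obtain e where e: "e \<in> {(v, u), (u, v)}" "e \<in> arrows0 Q"
      "\<forall>b\<in>arrows0 Q. b = (v, u) \<or> b = (u, v) \<longrightarrow> b = e"
    using edge[OF u(2)] by blast
  show ?thesis
  proof (cases "\<exists>w. w \<in> S \<and> neighbors Q v w \<and> w \<noteq> u")
    case False
    then have only: "x = u" if "x \<in> S" "neighbors Q v x" for x using that by blast
    have "arrows_in Q (insert v S) = insert e (arrows_in Q S)"
    proof
      show "arrows_in Q (insert v S) \<subseteq> insert e (arrows_in Q S)"
      proof
        fix b assume b: "b \<in> arrows_in Q (insert v S)"
        obtain x y where xy: "b = (x, y)" by (cases b)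
        consider "x \<in> S" "y \<in> S" | "x = v" "y = u" | "x = u" "y = v"
          using b only[of x] only[of y] out[of x] out[of y] vv unfolding arrows_in_def xy by auto
        then show "b \<in> insert e (arrows_in Q S)"
          by cases (use b e(3) in \<open>auto simp: xy arrows_in_def\<close>)
      qed
      show "insert e (arrows_in Q S) \<subseteq> arrows_in Q (insert v S)"
        using e u subA unfolding arrows_in_def by blast
    qed
    moreover have "e \<notin> arrows_in Q S" using e(1) v by (auto simp: arrows_in_def)
    moreover have "cycles_in Q (insert v S) = cycles_in Q S"
    proof -
      have False if "T \<in> cycles_in Q (insert v S)" "T \<notin> cycles_in Q S" for T
        using cycles_in_insert[OF that cq] only out by metis
      then show ?thesis using subC by blast
    qed
    ultimately show ?thesis using count cS finA by simp
  next
    case True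
    then obtain w where w: "w \<in> S" "neighbors Q v w" "w \<noteq> u" by blast
    have uw: "neighbors Q u w" using clq[OF u w(1,2)] w(3) by blast
    \<comment> \<open>A third neighbor \<open>x\<close> would also be adjacent to \<open>u\<close>,
      putting the edge between \<open>v\<close> and \<open>u\<close> in the triangles with
      \<open>w\<close> and with \<open>x\<close>.\<close>
    have only: "x = u \<or> x = w" if "x \<in> S" "neighbors Q v x" for x
    proof (rule ccontr)
      assume "\<not> (x = u \<or> x = w)"
      then have "neighbors Q u x" using clq[OF u that] by blast
      then show False
        using Qn_edge_in_one_triangle[OF Q u(2) w(2) uw that(2)] \<open>\<not> (x = u \<or> x = w)\<close> by blast
    qed
    obtain e' where e': "e' \<in> {(v, w), (w, v)}" "e' \<in> arrows0 Q"
        "\<forall>b\<in>arrows0 Q. b = (v, w) \<or> b = (w, v) \<longrightarrow> b = e'"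
      using edge[OF w(2)] by blast
    have "arrows_in Q (insert v S) = insert e (insert e' (arrows_in Q S))"
    proof
      show "arrows_in Q (insert v S) \<subseteq> insert e (insert e' (arrows_in Q S))"
      proof
        fix b assume b: "b \<in> arrows_in Q (insert v S)"
        obtain x y where xy: "b = (x, y)" by (cases b)
        consider "x \<in> S" "y \<in> S" | "x = v" "y = u" | "x = v" "y = w" | "x = u" "y = v" | "x = w" "y = v"
          using b only[of x] only[of y] out[of x] out[of y] vv unfolding arrows_in_def xy by auto
        then show "b \<in> insert e (insert e' (arrows_in Q S))"
          by cases (use b e(3) e'(3) in \<open>auto simp: xy arrows_in_def\<close>)
      qed
      show "insert e (insert e' (arrows_in Q S)) \<subseteq> arrows_in Q (insert v S)"
        using e(1,2) e'(1,2) u w subA unfolding arrows_in_def by blast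
    qed
    moreover have "e \<notin> insert e' (arrows_in Q S)" "e' \<notin> arrows_in Q S"
      using e(1) e'(1) v u(1) w(1,3) by (auto simp: arrows_in_def)
    ultimately have cA: "card (arrows_in Q (insert v S)) = card (arrows_in Q S) + 2"
      using finA by simp
    have t: "triangle Q v u w" using triangleI[OF cq u(2) uw sy[OF w(2)]] .
    then have "admissible 1 Q v u w" using Q by (auto simp: Qn_def)
    \<comment> \<open>Here \<open>y\<close>, \<open>z\<close> are \<open>u\<close>, \<open>w\<close>
      in the order in which the oriented triangle visits them after \<open>v\<close>.\<close>
    then obtain y z where yz: "{y, z} = {u, w}" "(v, y) \<in> arrows0 Q" "(y, z) \<in> arrows0 Q"
        "(z, v) \<in> arrows0 Q"
      by (cases rule: admissible_oriented[OF cq t]) (blast intro: that[of u w] that[of w u])+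
    have yzS: "y \<in> S" "z \<in> S" using yz(1) u(1) w(1) by auto
    have new: "cyc3 v y z \<in> cycles_in Q (insert v S)" "cyc3 v y z \<notin> cycles_in Q S"
      using oriented_3cyclesI[OF cq yz(2-4)] yzS v
      by (auto simp: cycles_in_def cyc3_def)
    \<comment> \<open>Another new 3-cycle could only visit \<open>y\<close> and \<open>z\<close> in
      the opposite order, which would need the reverse of the arrow from \<open>y\<close> to
      \<open>z\<close>.\<close>
    have "T = cyc3 v y z" if T: "T \<in> cycles_in Q (insert v S)" "T \<notin> cycles_in Q S" for T
    proof -
      obtain y' z' where c: "T = cyc3 v y' z'" "y' \<in> S" "z' \<in> S" "y' \<noteq> z'" "(v, y') \<in> arrows0 Q"
          "(y', z') \<in> arrows0 Q" "(z', v) \<in> arrows0 Q"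
        using cycles_in_insert[OF T cq] by blast
      then have "y' \<in> {y, z}" "z' \<in> {y, z}" using only out unfolding yz(1) by blast+
      moreover have "\<not> (y' = z \<and> z' = y)" using asy[OF yz(3)] c(6) by blast
      ultimately show ?thesis using c(1,4) by blast
    qed
    then have "cycles_in Q (insert v S) = insert (cyc3 v y z) (cycles_in Q S)"
      using new subC by blast
    then have "card (cycles_in Q (insert v S)) = Suc (card (cycles_in Q S))"
      using new finC by simp
    then show ?thesis using cA count cS by simp
  qed
qed

lemma restr_insert_connected:
  assumes cq: "colored_quiver m Q"
    and con: "\<forall>x\<in>S. \<forall>y\<in>S. (x, y) \<in> (restr Q S)\<^sup>*"
    and u: "u \<in> S" "neighbors Q v u" and xy: "x \<in> insert v S" "y \<in> insert v S"
  shows "(x, y) \<in> (restr Q (insert v S))\<^sup>*"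
proof -
  have sub: "(restr Q S)\<^sup>* \<subseteq> (restr Q (insert v S))\<^sup>*"
    by (rule rtrancl_mono) (auto simp: restr_def)
  have "(v, u) \<in> restr Q (insert v S)" "(u, v) \<in> restr Q (insert v S)"
    using u neighbors_sym[OF cq] by (auto simp: restr_def adj_def)
  then have "(x, u) \<in> (restr Q (insert v S))\<^sup>*" "(u, y) \<in> (restr Q (insert v S))\<^sup>*"
    using xy u(1) con sub by blast+
  then show ?thesis by (rule rtrancl_trans)
qed

text \<open>A single vertex satisfies the count, and adding an adjacent vertex preserves it. By
  finiteness there is a maximal connected set with the count; it is closed under neighbors, hence
  contains all vertices.\<close>

lemma Qn_euler:
  assumes Q: "Q \<in> Qn 1 n"
  shows "card (verts Q) + card (oriented_3cycles Q) = 1 + card (arrows0 Q)"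
proof -
  have cq: "colored_quiver 1 Q" and cn: "connected_quiver Q" using Q by (auto simp: Qn_def)
  have fin: "finite (verts Q)" using finite_verts[OF cq] .
  define good where "good S \<longleftrightarrow> S \<subseteq> verts Q \<and> S \<noteq> {} \<and>
     (\<forall>x\<in>S. \<forall>y\<in>S. (x, y) \<in> (restr Q S)\<^sup>*) \<and>
     card S + card (cycles_in Q S) = 1 + card (arrows_in Q S)" for S
  obtain r where r: "r \<in> verts Q" using cn unfolding connected_quiver_def by blast
  have "(r, r) \<notin> arrows0 Q" using arrows0_asym[OF cq] by blast
  then have "arrows_in Q {r} = {}" by (auto simp: arrows_in_def)
  moreover have "cycles_in Q {r} = {}"
    by (auto simp: cycles_in_def oriented_3cycles_def)
  ultimately have r0: "cycles_in Q {r} = {}" "arrows_in Q {r} = {}" by simp_all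
  then have "good {r}" using r r0 by (simp add: good_def)
  then obtain S where S: "good S" and max: "\<And>S'. good S' \<Longrightarrow> S \<subseteq> S' \<Longrightarrow> S' = S"
  proof -
    have "{S. good S} \<subseteq> Pow (verts Q)" by (auto simp: good_def)
    then have "finite {S. good S}" using fin finite_subset by blast
    then obtain S where "S \<in> {S. good S}" "\<forall>S'\<in>{S. good S}. S \<subseteq> S' \<longrightarrow> S = S'"
      using finite_has_maximal2[of "{S. good S}" "{r}"] \<open>good {r}\<close> by blast
    then show ?thesis using that[of S] by blast
  qed
  have con: "\<forall>x\<in>S. \<forall>y\<in>S. (x, y) \<in> (restr Q S)\<^sup>*"
    and sub: "S \<subseteq> verts Q" and ne: "S \<noteq> {}"
    and count: "card S + card (cycles_in Q S) = 1 + card (arrows_in Q S)"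
    using S unfolding good_def by blast+
  have closed: "v \<in> S" if "u \<in> S" "neighbors Q u v" for u v
  proof (rule ccontr)
    assume v: "v \<notin> S"
    have vu: "neighbors Q v u" using neighbors_sym[OF cq that(2)] .
    have "good (insert v S)"
      unfolding good_def
    proof (intro conjI ballI)
      show "insert v S \<subseteq> verts Q" using sub neighbors_verts(1)[OF cq vu] by simp
      show "(x, y) \<in> (restr Q (insert v S))\<^sup>*" if "x \<in> insert v S" "y \<in> insert v S" for x y
        using restr_insert_connected[OF cq con \<open>u \<in> S\<close> vu that] .
    qed (use Qn_grow_count[OF Q sub con v that(1) vu count] in auto)
    then show False using max v by blast
  qed
  have "S = verts Q"
  proof
    obtain s where s: "s \<in> S" using ne by blast
    show "verts Q \<subseteq> S"
    proof
      fix x assume "x \<in> verts Q"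
      then have "(s, x) \<in> (adj Q)\<^sup>*" using cn s sub unfolding connected_quiver_def by blast
      then show "x \<in> S"
        by (induction rule: rtrancl_induct) (use s closed in \<open>auto simp: adj_def\<close>)
    qed
  qed (rule sub)
  moreover have sub0: "arrows0 Q \<subseteq> verts Q \<times> verts Q"
    using arr_bounds[OF cq] by (auto simp: arrows0_def)
  then have "arrows_in Q (verts Q) = arrows0 Q" by (auto simp: arrows_in_def)
  moreover have "T \<subseteq> verts Q \<times> verts Q" if "T \<in> oriented_3cycles Q" for T
    using oriented_3cycles_subset[OF that] sub0 by (rule subset_trans)
  then have "cycles_in Q (verts Q) = oriented_3cycles Q" unfolding cycles_in_def by blast
  ultimately show ?thesis using count by simp
qed

text \<open>Two 3-cycles sharing an arrow would put its edge in two triangles, so the 3-cycles are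
  disjoint sets of three arrows each, and the arrows outside them are the free ones.\<close>

lemma Qn_card_arrows0:
  assumes Q: "Q \<in> Qn 1 n"
  shows "card (arrows0 Q) = card (free_arrows Q) + 3 * card (oriented_3cycles Q)"
proof -
  have cq: "colored_quiver 1 Q" using Q by (simp add: Qn_def)
  note ni = neighbors_iff_arrows0[OF cq]
  have card3: "card T = 3" if "T \<in> oriented_3cycles Q" for T
    using that card_cyc3 oriented_3cycles_nonempty oriented_3cycles_at_arrow by metis
  have same: "T = T'" if T: "T \<in> oriented_3cycles Q" "T' \<in> oriented_3cycles Q" "b \<in> T" "b \<in> T'"
    for T T' b
  proof -
    obtain x y where b: "b = (x, y)" by (cases b)
    obtain z where z: "T = cyc3 x y z" "(x, y) \<in> arrows0 Q" "(y, z) \<in> arrows0 Q" "(z, x) \<in> arrows0 Q"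
      using oriented_3cycles_at_arrow T(1,3) b by metis
    obtain z' where z': "T' = cyc3 x y z'" "(y, z') \<in> arrows0 Q" "(z', x) \<in> arrows0 Q"
      using oriented_3cycles_at_arrow T(2,4) b by metis
    show ?thesis using Qn_edge_in_one_triangle[OF Q, of x y z z'] z z' ni by blast
  qed
  have finO: "finite (oriented_3cycles Q)" and finA: "finite (arrows0 Q)"
    using finite_oriented_3cycles[OF cq] finite_arrows0[OF cq] .
  have finT: "finite T" if "T \<in> oriented_3cycles Q" for T
    using that finA oriented_3cycles_subset finite_subset by blast
  have "card (\<Union>(oriented_3cycles Q)) = (\<Sum>T\<in>oriented_3cycles Q. card T)"
    by (rule card_Union_disjoint) (use same finT in \<open>auto simp: pairwise_def disjnt_def\<close>)
  also have "\<dots> = 3 * card (oriented_3cycles Q)" using card3 by simp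
  finally have cU: "card (\<Union>(oriented_3cycles Q)) = 3 * card (oriented_3cycles Q)" .
  have "arrows0 Q = free_arrows Q \<union> \<Union>(oriented_3cycles Q)"
    using oriented_3cycles_subset unfolding free_arrows_def by blast
  moreover have "free_arrows Q \<inter> \<Union>(oriented_3cycles Q) = {}"
    unfolding free_arrows_def by blast
  ultimately show ?thesis
    using finA cU by (metis card_Un_disjoint finite_Un)
qed

lemma Qn_card_verts:
  assumes "Q \<in> Qn 1 n"
  shows "n = 1 + card (free_arrows Q) + 2 * card (oriented_3cycles Q)"
  using Qn_euler[OF assms] Qn_card_arrows0[OF assms] assms by (simp add: Qn_def)

subsection \<open>The central cycle\<close>

lemma ccw_structureD:
  assumes "ccw_structure m p q Q a D"
  shows "colored_quiver m Q" "induced_cycle m Q a" "cond_e m Q a D" "cond_f m Q a"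
    "cond_g m p q Q a D"
  using assms unfolding ccw_structure_def cond_a_def central_cycle_def by blast+

lemma induced_cycleD:
  assumes "induced_cycle m Q xs"
  shows "2 \<le> length xs" "distinct xs"
  using assms[unfolded induced_cycle_def, THEN conjunct1]
    assms[unfolded induced_cycle_def, THEN conjunct2, THEN conjunct1] .

lemma cond_e_long:
  assumes "cond_e m Q a D" "length a \<noteq> 2" "i < length a"
  shows "max_edge_clique Q a i (D i)" "card (D i) \<le> m + 2"
    "max_edge_clique Q a i K \<Longrightarrow> K = D i"
  using assms(1,3) unfolding cond_e_def if_not_P[OF assms(2)] by blast+

lemma cond_e_short:
  assumes "cond_e m Q a D" "length a = 2" "v \<in> set a"
  shows "central_pair_cliques m Q a v (D 0) (D 1)"
  using assms(1,3) unfolding cond_e_def if_P[OF assms(2)] by blast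

text \<open>Common ground for the two descriptions of \<open>D i\<close>: for \<open>l = 2\<close>
  the cliques come from the clique pair meeting in the central vertices, otherwise
  \<open>D i\<close> is a maximal clique on its edge. The bound 3 is \<open>m + 2\<close>.\<close>

lemma boundary_clique:
  assumes "ccw_structure 1 p q Q a D" "i < length a"
  shows "clique Q (D i)" "a ! i \<in> D i" "nxt a i \<in> D i" "a ! i \<noteq> nxt a i"
    "finite (D i)" "card (D i) \<le> 3" "length a = 3 \<Longrightarrow> D i \<noteq> set a"
proof -
  have cq: "colored_quiver 1 Q" and e: "cond_e 1 Q a D" and ic: "induced_cycle 1 Q a"
    using ccw_structureD[OF assms(1)] by blast+
  have len: "2 \<le> length a" "distinct a" using induced_cycleD[OF ic] .
  have lt: "Suc i mod length a < length a" using assms(2) by (intro mod_less_divisor) linarith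
  have "Suc i mod length a \<noteq> i"
  proof (cases "Suc i = length a")
    case True then show ?thesis using len(1) by simp
  next
    case False then show ?thesis using assms(2) by simp
  qed
  then show "a ! i \<noteq> nxt a i"
    unfolding nxt_def using lt by (simp add: nth_eq_iff_index_eq[OF len(2) assms(2)])
  have "nxt a i \<in> set a" unfolding nxt_def using lt by (rule nth_mem)
  have "clique Q (D i) \<and> a ! i \<in> D i \<and> nxt a i \<in> D i \<and> card (D i) \<le> 3 \<and>
      (length a = 3 \<longrightarrow> D i \<noteq> set a)"
  proof (cases "length a = 2")
    case True
    then have "central_pair_cliques 1 Q a (a ! i) (D 0) (D 1)"
      by (rule cond_e_short[OF e _ nth_mem[OF assms(2)]])
    then have "clique Q (D 0)" "clique Q (D 1)" "card (D 0) \<le> 3" "card (D 1) \<le> 3"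
        "D 0 \<inter> D 1 = set a"
      unfolding central_pair_cliques_def clique_pair_def by simp_all
    moreover have "i = 0 \<or> i = 1" using True assms(2) by auto
    ultimately have "clique Q (D i)" "card (D i) \<le> 3" "set a \<subseteq> D i" by blast+
    then show ?thesis
      using True \<open>nxt a i \<in> set a\<close> nth_mem[OF assms(2)] by auto
  next
    case False
    have "D i \<in> edge_cliques Q a i"
      using cond_e_long(1)[OF e False assms(2)] unfolding max_edge_clique_def by blast
    then show ?thesis
      using cond_e_long(2)[OF e False assms(2)] by (auto simp: edge_cliques_def)
  qed
  then show "clique Q (D i)" "a ! i \<in> D i" "nxt a i \<in> D i" "card (D i) \<le> 3"
    "length a = 3 \<Longrightarrow> D i \<noteq> set a" by auto
  then show "finite (D i)"
    using finite_subset[OF _ finite_verts[OF cq]] unfolding clique_def by blast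
qed

section \<open>3-cycles on central arrows and the peripheral vertices\<close>

lemma central_arrow_cases:
  assumes "ccw_structure 1 p q Q a D" "i < length a"
  obtains "central_arrow Q a i = (a ! i, nxt a i)" "col Q (a ! i) (nxt a i) = 0"
      "central_arrow Q a i \<in> arrows0 Q"
    | "central_arrow Q a i = (nxt a i, a ! i)" "col Q (a ! i) (nxt a i) = 1"
      "central_arrow Q a i \<in> arrows0 Q"
proof -
  have cq: "colored_quiver 1 Q" using ccw_structureD(1)[OF assms(1)] .
  have "neighbors Q (a ! i) (nxt a i)"
    using boundary_clique[OF assms] unfolding clique_def by blast
  then show ?thesis
    using that by (cases rule: neighbors_col_cases[OF cq]) (auto simp: central_arrow_def)
qed

text \<open>Orientation would give the central triangle the color sum 0 or 3, whereas centrality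
  requires \<open>0 < h < 3\<close>.\<close>

lemma central_triangle_not_oriented:
  assumes ccw: "ccw_structure 1 p q Q a D" and l: "length a = 3"
    and T: "T \<in> oriented_3cycles Q"
  shows "Field T \<noteq> set a"
proof
  assume F: "Field T = set a"
  have cq: "colored_quiver 1 Q" using ccw_structureD(1)[OF ccw] .
  obtain h where h: "0 < h" "h < 3" "cycle_color Q a = h"
    using ccw_structureD(5)[OF ccw] l unfolding cond_g_def by auto
  have da: "distinct a" by (rule induced_cycleD(2)[OF ccw_structureD(2)[OF ccw]])
  obtain x y z where a: "a = [x, y, z]"
    using l by (auto simp: numeral_3_eq_3 length_Suc_conv)
  have "x \<in> Field T" using F a by simp
  \<comment> \<open>Every vertex of a 3-cycle is the source of one of its arrows, so
    \<open>T\<close> can be started at the first vertex of \<open>a\<close> and then runs along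
    \<open>a\<close> or against it.\<close>
  moreover have "Field T = Domain T"
    using T unfolding oriented_3cycles_def Field_def by auto
  ultimately have "x \<in> Domain T" by simp
  then obtain y' where "(x, y') \<in> T" by blast
  then obtain z' where z: "T = cyc3 x y' z'" "distinct [x, y', z']" "(x, y') \<in> arrows0 Q"
      "(y', z') \<in> arrows0 Q" "(z', x) \<in> arrows0 Q"
    using oriented_3cycles_at_arrow[OF T] by metis
  then have "{x, y', z'} = {x, y, z}" using F a by simp
  moreover have "x \<noteq> y'" "x \<noteq> z'" using z(2) by auto
  ultimately consider "y' = y" "z' = z" | "y' = z" "z' = y"
    using da unfolding a by fastforce
  then have "cycle_color Q a = 0 \<or> cycle_color Q a = 3"
  proof cases
    case 1
    then show ?thesis unfolding a cycle_color_triple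
      using col_eq_0[OF cq z(3)] col_eq_0[OF cq z(4)] col_eq_0[OF cq z(5)] by simp
  next
    case 2
    then show ?thesis unfolding a cycle_color_triple
      using col_eq_1[OF cq z(3)] col_eq_1[OF cq z(4)] col_eq_1[OF cq z(5)] by simp
  qed
  then show False using h by auto
qed

text \<open>For \<open>l = 2\<close> containment in \<open>D i\<close> is built into
  \<open>central_3cycles\<close>. Otherwise the triangle is not the central one, so it extends to a
  maximal clique on the \<open>i\<close>-th edge, which is \<open>D i\<close> by uniqueness. As
  \<open>D i\<close> has at most three vertices, equality follows.\<close>

lemma central_3cycle_Field:
  assumes ccw: "ccw_structure 1 p q Q a D" and i: "i < length a"
    and T: "T \<in> central_3cycles Q a D i"
  shows "Field T = D i"
proof -
  have cq: "colored_quiver 1 Q" and e: "cond_e 1 Q a D"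
    using ccw_structureD[OF ccw] by blast+
  have To: "T \<in> oriented_3cycles Q" and cT: "central_arrow Q a i \<in> T"
    and T2: "length a = 2 \<Longrightarrow> Field T \<subseteq> D i"
    using T by (auto simp: central_3cycles_def)
  obtain x y where xy: "central_arrow Q a i = (x, y)" "{x, y} = {a ! i, nxt a i}"
    by (metis central_arrow_def insert_commute)
  obtain z where z: "T = cyc3 x y z" "distinct [x, y, z]"
      "(x, y) \<in> arrows0 Q" "(y, z) \<in> arrows0 Q" "(z, x) \<in> arrows0 Q"
    using oriented_3cycles_at_arrow[OF To] cT xy by metis
  have F: "Field T = {x, y, z}" using z by simp
  then have c3: "card (Field T) = 3" using z(2) by simp
  have "Field T \<subseteq> D i"
  proof (cases "length a = 2")
    case True then show ?thesis by (rule T2)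
  next
    case False
    have "triangle Q x y z"
      using triangleI[OF cq] z neighbors_iff_arrows0[OF cq] by blast
    then have "clique Q (Field T)" using F by (simp add: triangle_def)
    then have mem: "Field T \<in> edge_cliques Q a i"
      using F xy(2) central_triangle_not_oriented[OF ccw _ To]
      by (auto simp: edge_cliques_def)
    have "edge_cliques Q a i \<subseteq> Pow (verts Q)" by (auto simp: edge_cliques_def clique_def)
    then have "finite (edge_cliques Q a i)"
      using finite_subset[OF _ finite_Pow_iff[THEN iffD2, OF finite_verts[OF cq]]] by blast
    then obtain K where "K \<in> edge_cliques Q a i" "Field T \<subseteq> K"
        "\<forall>K'\<in>edge_cliques Q a i. K \<subseteq> K' \<longrightarrow> K = K'"
      using finite_has_maximal2[OF _ mem] by blast
    then have "max_edge_clique Q a i K" unfolding max_edge_clique_def by blast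
    then have "K = D i" by (rule cond_e_long(3)[OF e False i])
    then show ?thesis using \<open>Field T \<subseteq> K\<close> by simp
  qed
  then show ?thesis
    using c3 boundary_clique(5,6)[OF ccw i] by (metis card_seteq)
qed

lemma central_3cycles_unique:
  assumes ccw: "ccw_structure 1 p q Q a D" and i: "i < length a"
    and T: "T \<in> central_3cycles Q a D i" "T' \<in> central_3cycles Q a D i"
  shows "T = T'"
proof -
  obtain x y where xy: "central_arrow Q a i = (x, y)" by fastforce
  have "(x, y) \<in> T" "(x, y) \<in> T'" "T \<in> oriented_3cycles Q" "T' \<in> oriented_3cycles Q"
    using T xy by (auto simp: central_3cycles_def)
  then obtain z z' where "T = cyc3 x y z" "distinct [x, y, z]" "T' = cyc3 x y z'" "distinct [x, y, z']"
    using oriented_3cycles_at_arrow by metis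
  moreover have "Field T = Field T'"
    using central_3cycle_Field[OF ccw i] T by simp
  ultimately show ?thesis by auto
qed

text \<open>Since \<open>D i\<close> has at most three vertices, \<open>w\<close> completes it to a
  triangle. This is never the exceptional central triangle, so it is admissible and hence oriented,
  and the color of the central edge decides between the sums 0 and 3.\<close>

lemma peripheral_vertex:
  assumes ccw: "ccw_structure 1 p q Q a D" and i: "i < length a"
    and w: "w \<in> D i - {a ! i, nxt a i}"
  shows "D i = {a ! i, nxt a i, w}" "central_3cycles Q a D i \<noteq> {}"
    "cycle_color Q [a ! i, nxt a i, w] = 3 * col Q (a ! i) (nxt a i)"
proof -
  have cq: "colored_quiver 1 Q" and f: "cond_f 1 Q a"
    using ccw_structureD[OF ccw] by blast+
  note D = boundary_clique[OF ccw i]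
  let ?x = "a ! i" and ?y = "nxt a i"
  have "{?x, ?y, w} \<subseteq> D i" "card {?x, ?y, w} = 3" using w D by auto
  then show Di: "D i = {?x, ?y, w}" using D(5,6) by (metis card_seteq)
  have t: "triangle Q ?x ?y w"
    using D(1,4) w unfolding Di by (auto simp: triangle_def)
  then have ad: "admissible 1 Q ?x ?y w"
    using f D(7) unfolding Di cond_f_def by blast
  show "cycle_color Q [?x, ?y, w] = 3 * col Q ?x ?y"
    by (cases rule: admissible_oriented[OF cq t ad]) auto
  show "central_3cycles Q a D i \<noteq> {}"
  proof (cases rule: admissible_oriented[OF cq t ad])
    case 1
    then have "cyc3 ?x ?y w \<in> oriented_3cycles Q" by (intro oriented_3cyclesI[OF cq])
    then have "cyc3 ?x ?y w \<in> central_3cycles Q a D i"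
      using 1 Di by (simp add: central_3cycles_def central_arrow_def) (simp add: cyc3_def)
    then show ?thesis by blast
  next
    case 2
    then have "cyc3 ?y ?x w \<in> oriented_3cycles Q" by (intro oriented_3cyclesI[OF cq])
    then have "cyc3 ?y ?x w \<in> central_3cycles Q a D i"
      using 2 Di by (simp add: central_3cycles_def central_arrow_def insert_commute) (simp add: cyc3_def)
    then show ?thesis by blast
  qed
qed

text \<open>Both sets have at most one element and are nonempty together: a peripheral vertex yields
  a 3-cycle, and conversely a central 3-cycle fills \<open>D i\<close> with three vertices, one of
  them off the edge.\<close>

lemma card_peripheral_eq_central_3cycles:
  assumes ccw: "ccw_structure 1 p q Q a D" and i: "i < length a"
  shows "card (D i - {a ! i, nxt a i}) = card (central_3cycles Q a D i)"
    "central_3cycles Q a D i \<noteq> {} \<Longrightarrow> card (central_3cycles Q a D i) = 1"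
proof -
  have one: "card (central_3cycles Q a D i) = 1" if ne: "central_3cycles Q a D i \<noteq> {}"
  proof -
    obtain T where "T \<in> central_3cycles Q a D i" using ne by blast
    then have "central_3cycles Q a D i = {T}" using central_3cycles_unique[OF ccw i] by blast
    then show ?thesis by simp
  qed
  show "card (central_3cycles Q a D i) = 1" if "central_3cycles Q a D i \<noteq> {}"
    using one[OF that] .
  show "card (D i - {a ! i, nxt a i}) = card (central_3cycles Q a D i)"
  proof (cases "\<exists>w. w \<in> D i - {a ! i, nxt a i}")
    case True
    then obtain w where w: "w \<in> D i - {a ! i, nxt a i}" by blast
    then have "D i - {a ! i, nxt a i} = {w}" using peripheral_vertex(1)[OF ccw i w] by blast
    then show ?thesis using one peripheral_vertex(2)[OF ccw i w] by simp
  next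
    case False
    have "T \<notin> central_3cycles Q a D i" for T
    proof
      assume T: "T \<in> central_3cycles Q a D i"
      then have F: "Field T = D i" by (rule central_3cycle_Field[OF ccw i])
      obtain x y z where "T = cyc3 x y z" "distinct [x, y, z]"
        using T unfolding central_3cycles_def oriented_3cycles_def cyc3_def by blast
      then have "card (D i) = 3" unfolding F[symmetric] by simp
      moreover have "D i \<subseteq> {a ! i, nxt a i}" using False by blast
      then have "card (D i) \<le> card {a ! i, nxt a i}" by (intro card_mono) auto
      then have "card (D i) \<le> 2" using boundary_clique(4)[OF ccw i] by simp
      ultimately show False by simp
    qed
    then have "central_3cycles Q a D i = {}" by blast
    moreover have "D i - {a ! i, nxt a i} = {}" using False by blast
    ultimately show ?thesis by (simp only: card.empty)
  qed
qed

text \<open>An edge without a 3-cycle contributes 1 to both sides. An edge with one contributes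
  itself and its peripheral vertex on the left, and 2 on the right. Nothing is counted twice, as
  different edges share neither peripheral vertices nor 3-cycles.\<close>

lemma central_edges_count:
  assumes ccw: "ccw_structure 1 p q Q a D" and I: "I \<subseteq> {..<length a}"
  shows "card I + card (\<Union>i\<in>I. D i - {a ! i, nxt a i}) =
    card {i \<in> I. central_3cycles Q a D i = {}} + 2 * card (\<Union>i\<in>I. central_3cycles Q a D i)"
proof -
  let ?Z = "central_3cycles Q a D" and ?P = "\<lambda>i. D i - {a ! i, nxt a i}"
  have cq: "colored_quiver 1 Q" and g: "cond_g 1 p q Q a D" using ccw_structureD[OF ccw] by blast+
  have finI: "finite I" using I finite_subset by blast
  have i: "i < length a" if "i \<in> I" for i using I that by blast
  have uniq: "i = j" if "i < length a" "j < length a" "w \<in> ?P i" "w \<in> D j" for i j w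
  proof -
    have "w \<in> peripheral a D" using that by (auto simp: peripheral_def)
    then show ?thesis using g that unfolding cond_g_def by blast
  qed
  have disjP: "?P i \<inter> ?P j = {}" if "i \<in> I" "j \<in> I" "i \<noteq> j" for i j
    using uniq[of i j] that i by blast
  \<comment> \<open>A common 3-cycle would force \<open>D i = D j\<close>, and its peripheral vertex
    would then lie in two boundary subquivers.\<close>
  have disjZ: "?Z i \<inter> ?Z j = {}" if "i \<in> I" "j \<in> I" "i \<noteq> j" for i j
  proof (rule ccontr)
    assume "?Z i \<inter> ?Z j \<noteq> {}"
    then obtain T where T: "T \<in> ?Z i" "T \<in> ?Z j" by blast
    then have "D i = D j" using central_3cycle_Field[OF ccw] i that by metis
    moreover have "card (?P i) = 1"
      using card_peripheral_eq_central_3cycles[OF ccw i[OF that(1)]] T by auto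
    then obtain w where "w \<in> ?P i" by (metis card_1_singletonE insertI1)
    ultimately show False using uniq[of i j w] i that by blast
  qed
  have finZ: "finite (?Z i)" for i
    using finite_oriented_3cycles[OF cq] by (simp add: central_3cycles_def)
  have cP: "card (\<Union>i\<in>I. ?P i) = (\<Sum>i\<in>I. card (?P i))"
    using finI disjP boundary_clique(5)[OF ccw i] by (intro card_UN_disjoint) auto
  have cZ: "card (\<Union>i\<in>I. ?Z i) = (\<Sum>i\<in>I. card (?Z i))"
    using finI disjZ finZ by (intro card_UN_disjoint) auto
  have PZ: "(\<Sum>i\<in>I. card (?P i)) = (\<Sum>i\<in>I. card (?Z i))"
    using card_peripheral_eq_central_3cycles(1)[OF ccw i] by simp
  have "card I = (\<Sum>i\<in>I. (if ?Z i = {} then 1 else 0) + card (?Z i))"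
  proof -
    have "(if ?Z i = {} then 1 else 0) + card (?Z i) = 1" if "i \<in> I" for i
      using card_peripheral_eq_central_3cycles(2)[OF ccw i[OF that]] by auto
    then show ?thesis by simp
  qed
  also have "\<dots> = card {i \<in> I. ?Z i = {}} + (\<Sum>i\<in>I. card (?Z i))"
    using finI by (simp add: sum.distrib sum.If_cases Int_def)
  finally show ?thesis using cP cZ PZ by simp
qed

section \<open>Summation over the two directions\<close>

lemma W_color_eq:
  assumes ccw: "ccw_structure 1 p q Q a D"
  shows "W_color Q a D (3 * s) =
    (\<Union>i\<in>{i. i < length a \<and> col Q (a ! i) (nxt a i) = s}. D i - {a ! i, nxt a i})"
  using peripheral_vertex(3)[OF ccw] unfolding W_color_def by auto

text \<open>With colors 0 and 1 only, the color sum of the central cycle counts its clockwise edges.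
  This identifies \<open>h\<close> with their number and \<open>l - h\<close> with the number of
  counterclockwise ones.\<close>

lemma card_cw_ccw_edges:
  assumes ccw: "ccw_structure 1 p q Q a D"
  shows "card (cw_edges Q a) = cycle_color Q a"
    "card (ccw_edges Q a) + card (cw_edges Q a) = length a"
proof -
  let ?c = "\<lambda>i. col Q (a ! i) (nxt a i)"
  have c: "?c i = 0 \<or> ?c i = 1" if "i < length a" for i
    using central_arrow_cases[OF ccw that] by metis
  have "cycle_color Q a = (\<Sum>i<length a. if ?c i = 1 then 1 else 0)"
    unfolding cycle_color_def using c by (intro sum.cong) auto
  also have "\<dots> = card ({..<length a} \<inter> {i. ?c i = 1})" by (simp add: sum.If_cases)
  also have "{..<length a} \<inter> {i. ?c i = 1} = cw_edges Q a" by (auto simp: cw_edges_def)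
  finally show "card (cw_edges Q a) = cycle_color Q a" by simp
  have "ccw_edges Q a \<union> cw_edges Q a = {..<length a}"
    using c by (auto simp: ccw_edges_def cw_edges_def)
  moreover have "ccw_edges Q a \<inter> cw_edges Q a = {}" by (auto simp: ccw_edges_def cw_edges_def)
  ultimately show "card (ccw_edges Q a) + card (cw_edges Q a) = length a"
    by (metis card_Un_disjoint card_lessThan finite_Un finite_lessThan)
qed

lemma sum_nw:
  assumes ccw: "ccw_structure 1 p q Q a D"
  shows "(\<Sum>w\<in>W_color Q a D s. nw Q a D w) = card (W_color Q a D s)
    + (\<Sum>w\<in>W_color Q a D s. card (free_arrows (Qw Q a D w)))
    + 2 * (\<Sum>w\<in>W_color Q a D s. card (oriented_3cycles (Qw Q a D w)))"
proof -
  have "nw Q a D w = 1 + card (free_arrows (Qw Q a D w)) + 2 * card (oriented_3cycles (Qw Q a D w))"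
    if "w \<in> W_color Q a D s" for w
  proof -
    have "w \<in> peripheral a D" using that by (auto simp: W_color_def peripheral_def)
    then have "Qw Q a D w \<in> Qn 1 (nw Q a D w)"
      using ccw_structureD(5)[OF ccw] unfolding cond_g_def by auto
    then show ?thesis by (rule Qn_card_verts)
  qed
  then have "(\<Sum>w\<in>W_color Q a D s. nw Q a D w) = (\<Sum>w\<in>W_color Q a D s.
      1 + card (free_arrows (Qw Q a D w)) + 2 * card (oriented_3cycles (Qw Q a D w)))"
    by (rule sum.cong[OF refl])
  then show ?thesis unfolding sum.distrib sum_distrib_left by simp
qed

theorem corollary6p1:
  fixes Q :: "'a cquiver" and p q :: nat and a :: "'a list" and D :: "nat \<Rightarrow> 'a set"
  assumes "1 \<le> p" and "1 \<le> q"
    and "Q \<in> Qpq 1 p q"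
    and "ccw_structure 1 p q Q a D"
  shows "p = (r1' Q a D + r1'' Q a D) + 2 * (r2' Q a D + r2'' Q a D) \<and>
         q = (s1' Q a D + s1'' Q a D) + 2 * (s2' Q a D + s2'' Q a D)"
proof -
  note ccw = assms(4)
  obtain h where h: "cycle_color Q a = h" "p = (length a - h) + (\<Sum>w\<in>Wp 1 Q a D. nw Q a D w)"
      "q = h + (\<Sum>w\<in>Wq 1 Q a D. nw Q a D w)"
    using ccw_structureD(5)[OF ccw] unfolding cond_g_def by auto
  \<comment> \<open>For \<open>m = 1\<close> the color sums \<open>m - 1\<close> and
    \<open>2 * m + 1\<close> are \<open>3 * 0\<close> and \<open>3 * 1\<close>, so the peripheral
    vertices are sorted by the direction of their central arrow.\<close>
  have Wp: "Wp 1 Q a D = (\<Union>i\<in>ccw_edges Q a. D i - {a ! i, nxt a i})"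
    using W_color_eq[OF ccw, of 0] by (simp add: Wp_def ccw_edges_def)
  have Wq: "Wq 1 Q a D = (\<Union>i\<in>cw_edges Q a. D i - {a ! i, nxt a i})"
    using W_color_eq[OF ccw, of 1] by (simp add: Wq_def cw_edges_def)
  have "p = card (ccw_edges Q a) + card (Wp 1 Q a D) + r1'' Q a D + 2 * r2'' Q a D"
    using h(1,2) card_cw_ccw_edges[OF ccw] sum_nw[OF ccw, of "1 - 1"]
    by (simp add: Wp_def r1''_def r2''_def)
  moreover have "q = card (cw_edges Q a) + card (Wq 1 Q a D) + s1'' Q a D + 2 * s2'' Q a D"
    using h(1,3) card_cw_ccw_edges[OF ccw] sum_nw[OF ccw, of "2 * 1 + 1"]
    by (simp add: Wq_def s1''_def s2''_def)
  \<comment> \<open>The single vertices \<open>w\<close> split off from the \<open>Q_w\<close> pair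
    up with the central arrows that lie in a 3-cycle.\<close>
  moreover have "card (ccw_edges Q a) + card (Wp 1 Q a D) = r1' Q a D + 2 * r2' Q a D"
    unfolding Wp r1'_def r2'_def
    by (rule central_edges_count[OF ccw]) (auto simp: ccw_edges_def)
  moreover have "card (cw_edges Q a) + card (Wq 1 Q a D) = s1' Q a D + 2 * s2' Q a D"
    unfolding Wq s1'_def s2'_def
    by (rule central_edges_count[OF ccw]) (auto simp: cw_edges_def)
  ultimately show ?thesis by simp
qed

end
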